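(* Let $V$ be a countably generated Hilbert module over a unital $C^*$-algebra $A$. Then the completion $X$ of $V$ with respect to the topology $\tau_{\widehat V}$ coincides with the dual module $V'$, extending the canonical embedding of $V$ into $V'$.
   Context: Hilbert modules are right Hilbert $C^*$-modules, with $A$-valued inner product $\langle\cdot,\cdot\rangle$ that is $A$-linear in the second variable. A Hilbert $A$-module $V$ is countably generated if there is a sequence of elements of $V$ such that the set of all finite $A$-linear combinations of them is norm-dense in $V$. The dual module $V'$ is the set of all bounded $A$-linear maps from $V$ to $A$; the canonical embedding of $V$ into $V'$ is $x\mapsto\langle x,\cdot\rangle$. The topology $\tau_{\widehat V}$ on $V$ is the topology generated by the family of seminorms $x\mapsto\|\langle z,x\rangle\|$, $z\in V$. $X$ denotes the completion of $V$ with respect to $\tau_{\widehat V}$.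
   Formalization: The completion X is taken by Cauchy sequences instead of arbitrary Cauchy nets; with nets the claim fails for A = ℂ, V = ℓ², where the completion in the weak topology is the whole algebraic dual, larger than V'. *)

theory Defs
  imports "HOL-Analysis.Analysis"
begin

class complex_vector = real_vector +
  fixes scaleC :: "complex \<Rightarrow> 'a \<Rightarrow> 'a" (infixr "*\<^sub>C" 75)
  assumes scaleC_add_right: "c *\<^sub>C (x + y) = c *\<^sub>C x + c *\<^sub>C y"
    and scaleC_add_left: "(c + d) *\<^sub>C x = c *\<^sub>C x + d *\<^sub>C x"
    and scaleC_scaleC: "c *\<^sub>C (d *\<^sub>C x) = (c * d) *\<^sub>C x"
    and scaleC_one: "1 *\<^sub>C x = x"
    and scaleR_scaleC: "r *\<^sub>R x = complex_of_real r *\<^sub>C x"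

class complex_banach = complex_vector + banach +
  assumes norm_scaleC: "norm (c *\<^sub>C x) = cmod c * norm x"

text \<open>The superclass is \<open>real_normed_algebra + monoid_mult\<close> rather than
  \<open>real_normed_algebra_1\<close> because the latter excludes the zero algebra; for all other
  algebras \<open>norm 1 = 1\<close> follows from the C*-identity.\<close>

class unital_cstar_algebra = complex_banach + real_normed_algebra + monoid_mult +
  fixes cstar :: "'a \<Rightarrow> 'a"
  assumes mult_scaleC_left: "(c *\<^sub>C a) * b = c *\<^sub>C (a * b)"
    and mult_scaleC_right: "a * (c *\<^sub>C b) = c *\<^sub>C (a * b)"
    and cstar_cstar: "cstar (cstar a) = a"
    and cstar_add: "cstar (a + b) = cstar a + cstar b"
    and cstar_scaleC: "cstar (c *\<^sub>C a) = cnj c *\<^sub>C cstar a"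
    and cstar_mult: "cstar (a * b) = cstar b * cstar a"
    and cstar_identity: "norm (cstar a * a) = (norm a)\<^sup>2"

definition cstar_positive :: "'a::unital_cstar_algebra \<Rightarrow> bool" where
  "cstar_positive a \<longleftrightarrow> (\<exists>b. a = cstar b * b)"

text \<open>The norm of the type \<open>'v\<close> is tied to the inner product by \<open>norm_ip\<close>, so that the
  sort \<open>complex_banach\<close> expresses completeness in the Hilbert module norm.\<close>

locale hilbert_module =
  fixes act :: "'v::complex_banach \<Rightarrow> 'a::unital_cstar_algebra \<Rightarrow> 'v"
    and ip :: "'v \<Rightarrow> 'v \<Rightarrow> 'a"
  assumes act_add_left: "act (x + y) a = act x a + act y a"
    and act_add_right: "act x (a + b) = act x a + act x b"
    and act_act: "act (act x a) b = act x (a * b)"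
    and act_one: "act x 1 = x"
    and act_scaleC_left: "act (c *\<^sub>C x) a = c *\<^sub>C act x a"
    and act_scaleC_right: "act x (c *\<^sub>C a) = c *\<^sub>C act x a"
    and ip_add_right: "ip x (y + z) = ip x y + ip x z"
    and ip_scaleC_right: "ip x (c *\<^sub>C y) = c *\<^sub>C ip x y"
    and ip_act_right: "ip x (act y a) = ip x y * a"
    and cstar_ip: "cstar (ip x y) = ip y x"
    and ip_positive: "cstar_positive (ip x x)"
    and ip_definite: "ip x x = 0 \<Longrightarrow> x = 0"
    and norm_ip: "norm x = sqrt (norm (ip x x))"

definition countably_generated ::
    "('v::complex_banach \<Rightarrow> 'a::unital_cstar_algebra \<Rightarrow> 'v) \<Rightarrow> bool" where
  "countably_generated act \<longleftrightarrow>
    (\<exists>s :: nat \<Rightarrow> 'v. closure {\<Sum>i<n. act (s i) (a i) | (n :: nat) (a :: nat \<Rightarrow> 'a). True} = UNIV)"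

text \<open>Complex linearity of the elements of the dual module follows from \<open>A\<close>-linearity,
  because \<open>A\<close> is unital.\<close>

definition dual_module ::
    "('v::complex_banach \<Rightarrow> 'a::unital_cstar_algebra \<Rightarrow> 'v) \<Rightarrow> ('v \<Rightarrow> 'a) set" where
  "dual_module act = {f. bounded_linear f \<and> (\<forall>x a. f (act x a) = f x * a)}"

definition tau :: "('v::complex_banach \<Rightarrow> 'v \<Rightarrow> 'a::unital_cstar_algebra) \<Rightarrow> 'v topology" where
  "tau ip = topology_generated_by {{y. norm (ip z (y - x)) < e} | z x e. e > 0}"

definition tau_Cauchy ::
    "('v::complex_banach \<Rightarrow> 'v \<Rightarrow> 'a::unital_cstar_algebra) \<Rightarrow> (nat \<Rightarrow> 'v) \<Rightarrow> bool" where
  "tau_Cauchy ip x \<longleftrightarrow>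
    (\<forall>U. openin (tau ip) U \<and> 0 \<in> U \<longrightarrow> (\<exists>N. \<forall>m\<ge>N. \<forall>n\<ge>N. x m - x n \<in> U))"

definition tau_equiv ::
    "('v::complex_banach \<Rightarrow> 'v \<Rightarrow> 'a::unital_cstar_algebra) \<Rightarrow> ((nat \<Rightarrow> 'v) \<times> (nat \<Rightarrow> 'v)) set" where
  "tau_equiv ip = {(x, y). tau_Cauchy ip x \<and> tau_Cauchy ip y \<and>
     limitin (tau ip) (\<lambda>n. x n - y n) 0 sequentially}"

text \<open>The completion is the one by Cauchy sequences. Already for \<open>A = \<complex>\<close> the topology \<open>tau\<close> is
  the weak topology of a Hilbert space, whose completion by arbitrary Cauchy nets is the whole
  algebraic dual and hence larger than the dual module in infinite dimensions.\<close>

definition tau_completion ::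
    "('v::complex_banach \<Rightarrow> 'v \<Rightarrow> 'a::unital_cstar_algebra) \<Rightarrow> (nat \<Rightarrow> 'v) set set" where
  "tau_completion ip = {x. tau_Cauchy ip x} // tau_equiv ip"

definition tau_class ::
    "('v::complex_banach \<Rightarrow> 'v \<Rightarrow> 'a::unital_cstar_algebra) \<Rightarrow> (nat \<Rightarrow> 'v) \<Rightarrow> (nat \<Rightarrow> 'v) set" where
  "tau_class ip x = tau_equiv ip `` {x}"

text \<open>The continuous extension to the completion of the pseudometric
  \<open>(x, y) \<mapsto> norm (ip z (x - y))\<close>; the limit does not depend on the representatives.\<close>

definition completion_dist ::
    "('v::complex_banach \<Rightarrow> 'v \<Rightarrow> 'a::unital_cstar_algebra) \<Rightarrow> 'v \<Rightarrow>
      (nat \<Rightarrow> 'v) set \<Rightarrow> (nat \<Rightarrow> 'v) set \<Rightarrow> real" where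
  "completion_dist ip z \<xi> \<eta> =
    (THE d. \<exists>x\<in>\<xi>. \<exists>y\<in>\<eta>. (\<lambda>n. norm (ip z (x n - y n))) \<longlonglongrightarrow> d)"

definition completion_topology ::
    "('v::complex_banach \<Rightarrow> 'v \<Rightarrow> 'a::unital_cstar_algebra) \<Rightarrow> (nat \<Rightarrow> 'v) set topology" where
  "completion_topology ip = topology_generated_by
    {{\<eta> \<in> tau_completion ip. completion_dist ip z \<xi> \<eta> < e} | z \<xi> e. \<xi> \<in> tau_completion ip \<and> e > 0}"

text \<open>On the image of the canonical embedding the seminorms \<open>f \<mapsto> norm (f z)\<close> are those
  defining \<open>tau\<close>, since \<open>norm (ip x z) = norm (ip z x)\<close>.\<close>

definition dual_topology ::
    "('v::complex_banach \<Rightarrow> 'a::unital_cstar_algebra \<Rightarrow> 'v) \<Rightarrow> ('v \<Rightarrow> 'a) topology" where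
  "dual_topology act = topology_generated_by
    {{g \<in> dual_module act. norm (g z - f z) < e} | z f e. f \<in> dual_module act \<and> e > 0}"

end

(*
  For f in the dual module and a bounded sequence of finite rank operators T_n converging
  strongly to the identity, f o T_n is again of finite rank, hence of the form <x_n, .> with
  x_n in V, and <x_n, v> = f (T_n v) converges to f v. With generators t_i of norm at most 1 and
  the frame operator S = (1/n) * sum_(i<n) t_i <t_i, .>, 0 <= S <= 1, one takes
  T_n = 1 - (1 - S)^(n^2). Conversely the pointwise limit of the <x_n, .> for a Cauchy sequence
  (x_n) lies in the dual module by the uniform boundedness principle.
  The operator estimates need the order of A; it is obtained without spectral theory, from the
  square root of 1 - x for norm x <= 1 and the identity u* u = k^2 + m^2, u = k + i m.
*)
theory Submission
  imports Defs
begin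

text \<open>Hilbert modules need not be self-dual and closed submodules need not be complemented, so
  neither the Riesz theorem nor an orthonormal basis is at hand. What makes finite rank operators
  usable is \<open>A\<close>-linearity: f (t <t, v>) = f t <t, v>, which is the inner product of v
  with t acted on by \<open>cstar (f t)\<close>. The difficulty is strong convergence, since S has
  no lower bound. With D = 1 - S, what decays at a rate independent of S is <D^k y, S D^k y>, like
  1/k. The average S over N generators dominates each rank one term only after multiplication by N,
  so the fourth power of the norm of D^k t_i is at most N/k; the exponent k = N^2 turns this into
  1/N. Positivity of the inner product is given in the form b* b, while the estimates add positive
  elements and compare norms. The bridge, and the hard fact about the order, is that every b* b
  satisfies a norm criterion that is stable under sums.\<close>

section \<open>Scalars, involution and norm in a unital C*-algebra\<close>

lemma scaleC_minus_one: "(- 1) *\<^sub>C x = - (x::'a::complex_vector)"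
  using scaleR_scaleC[of "-1" x] by simp

lemma scaleC_minus_right: "c *\<^sub>C (- x) = - (c *\<^sub>C (x::'a::complex_vector))"
  by (simp add: scaleC_scaleC flip: scaleC_minus_one)

lemma scaleC_minus_left: "(- c) *\<^sub>C x = - (c *\<^sub>C (x::'a::complex_vector))"
  by (simp add: scaleC_scaleC flip: scaleC_minus_one)

lemma scaleC_diff_right: "c *\<^sub>C (x - y) = c *\<^sub>C x - c *\<^sub>C (y::'a::complex_vector)"
  by (simp only: diff_conv_add_uminus scaleC_add_right scaleC_minus_right)

lemma bounded_linear_scaleC: "bounded_linear (\<lambda>x::'a::complex_banach. c *\<^sub>C x)"
  by (rule bounded_linear_intro[where K = "cmod c"])
    (simp_all add: scaleC_add_right scaleR_scaleC scaleC_scaleC norm_scaleC mult.commute)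

lemma scaleC_i_i: "\<i> *\<^sub>C \<i> *\<^sub>C x = - (x::'a::complex_vector)"
  by (simp add: scaleC_scaleC scaleC_minus_one)

lemma cstar_zero [simp]: "cstar (0::'a::unital_cstar_algebra) = 0"
  using cstar_add[of "0::'a" 0] by simp

lemma cstar_minus: "cstar (- a) = - cstar (a::'a::unital_cstar_algebra)"
  using cstar_add[of a "- a"] by (simp add: add_eq_0_iff)

lemma cstar_diff: "cstar (a - b) = cstar a - cstar (b::'a::unital_cstar_algebra)"
  by (metis cstar_add cstar_minus diff_conv_add_uminus)

lemma cstar_scaleR: "cstar (r *\<^sub>R a) = r *\<^sub>R cstar (a::'a::unital_cstar_algebra)"
  by (simp add: scaleR_scaleC cstar_scaleC)

lemma cstar_one [simp]: "cstar (1::'a::unital_cstar_algebra) = 1"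
  by (metis cstar_cstar cstar_mult mult_1 mult_1_right)

lemma cstar_power: "cstar (a ^ n) = cstar (a::'a::unital_cstar_algebra) ^ n"
  by (induction n) (simp_all add: cstar_mult power_commutes)

lemma norm_cstar [simp]: "norm (cstar a) = norm (a::'a::unital_cstar_algebra)"
proof -
  have le: "norm b \<le> norm (cstar b)" for b :: 'a
  proof (cases "b = 0")
    case False
    have "norm b * norm b \<le> norm (cstar b) * norm b"
      using norm_mult_ineq[of "cstar b" b] by (simp add: cstar_identity power2_eq_square)
    then show ?thesis using False by simp
  qed simp
  show ?thesis using le[of a] le[of "cstar a"] by (simp add: cstar_cstar)
qed

lemma norm_mult_cstar: "norm (a * cstar a) = (norm (a::'a::unital_cstar_algebra))\<^sup>2"
  using cstar_identity[of "cstar a"] by (simp add: cstar_cstar)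

lemma bounded_linear_cstar: "bounded_linear (cstar :: 'a::unital_cstar_algebra \<Rightarrow> 'a)"
  by (rule bounded_linear_intro[where K = 1]) (simp_all add: cstar_add cstar_scaleR)

lemma norm_one_le: "norm (1::'a::unital_cstar_algebra) \<le> 1"
  using cstar_identity[of "1::'a"] by (cases "norm (1::'a) = 0") (auto simp: power2_eq_square)

lemma norm_scaleR_one_le: "t \<ge> 0 \<Longrightarrow> norm (t *\<^sub>R (1::'a::unital_cstar_algebra)) \<le> t"
  using mult_left_mono[OF norm_one_le[where 'a='a], of t] by simp

lemma norm_power_le:
  assumes "norm (a::'a::unital_cstar_algebra) \<le> 1" shows "norm (a ^ n) \<le> 1"
proof (induction n)
  case (Suc n)
  have "norm (a * a ^ n) \<le> norm a * norm (a ^ n)" by (rule norm_mult_ineq)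
  also have "\<dots> \<le> 1" using assms Suc by (simp add: mult_le_one)
  finally show ?case by simp
qed (simp add: norm_one_le)

section \<open>Square roots of 1 - x by iteration\<close>

text \<open>The limit is \<open>1 - \<surd>(1 - x)\<close>. The increments are dominated by those of the bounded
  increasing scalar iteration at \<open>x = 1\<close>, which gives convergence up to \<open>norm x = 1\<close>.\<close>

fun sqrt_iter :: "'a::real_normed_algebra \<Rightarrow> nat \<Rightarrow> 'a" where
  "sqrt_iter x 0 = 0"
| "sqrt_iter x (Suc n) = (1/2) *\<^sub>R (x + sqrt_iter x n * sqrt_iter x n)"

lemma commute_sqrt_iter:
  assumes "b * x = x * b" shows "b * sqrt_iter x n = sqrt_iter x n * b"
proof (induction n)
  case (Suc n)
  have "b * (sqrt_iter x n * sqrt_iter x n) = sqrt_iter x n * sqrt_iter x n * b"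
    by (metis Suc mult.assoc)
  then show ?case using assms by (simp add: distrib_left distrib_right)
qed simp

lemma sqrt_iter_one_bounds: "0 \<le> sqrt_iter (1::real) n \<and> sqrt_iter (1::real) n \<le> 1"
proof (induction n)
  case (Suc n)
  then have "sqrt_iter (1::real) n * sqrt_iter 1 n \<le> 1" by (intro mult_le_one) auto
  with Suc show ?case by simp
qed simp

lemma norm_sqrt_iter_le:
  assumes "norm x \<le> 1" shows "norm (sqrt_iter x n) \<le> sqrt_iter 1 n"
proof (induction n)
  case (Suc n)
  have "norm (sqrt_iter x n * sqrt_iter x n) \<le> sqrt_iter 1 n * sqrt_iter 1 n"
    using norm_mult_ineq order_trans mult_mono[OF Suc Suc] sqrt_iter_one_bounds[of n] norm_ge_zero
    by blast
  then show ?case using assms norm_triangle_ineq[of x "sqrt_iter x n * sqrt_iter x n"] by simp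
qed simp

text \<open>The iterates commute, so a a - b b = (a - b) (a + b), and the factors are bounded by the
  scalar r - s and r + s. For the scalar iteration the same factorisation is an equality, which
  closes the induction.\<close>

lemma norm_sqrt_iter_diff_le:
  assumes "norm x \<le> 1"
  shows "norm (sqrt_iter x (Suc n) - sqrt_iter x n) \<le> sqrt_iter 1 (Suc n) - sqrt_iter 1 n"
proof (induction n)
  case 0
  show ?case using assms by simp
next
  case (Suc n)
  define a b where "a = sqrt_iter x (Suc n)" and "b = sqrt_iter x n"
  define r s where "r = sqrt_iter (1::real) (Suc n)" and "s = sqrt_iter (1::real) n"
  have "b * x = x * b" unfolding b_def by (rule commute_sqrt_iter[symmetric]) simp
  then have "a * b = b * a"
    by (simp add: a_def b_def distrib_left distrib_right mult.assoc)
  then have "a * a - b * b = (a - b) * (a + b)" by (simp add: algebra_simps)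
  then have "sqrt_iter x (Suc (Suc n)) - a = (1/2) *\<^sub>R ((a - b) * (a + b))"
    by (simp add: a_def b_def scaleR_right_diff_distrib[symmetric])
  then have "norm (sqrt_iter x (Suc (Suc n)) - a) = (1/2) * norm ((a - b) * (a + b))" by simp
  also have "\<dots> \<le> (1/2) * (norm (a - b) * norm (a + b))" by (simp add: norm_mult_ineq)
  also have "\<dots> \<le> (1/2) * ((r - s) * (r + s))"
    using Suc norm_sqrt_iter_le[OF assms, of n] norm_sqrt_iter_le[OF assms, of "Suc n"]
      norm_triangle_ineq[of a b]
    by (intro mult_left_mono mult_mono) (auto simp: a_def b_def r_def s_def
        simp del: sqrt_iter.simps dest: order_trans[OF norm_ge_zero])
  also have "\<dots> = sqrt_iter 1 (Suc (Suc n)) - r"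
    by (simp add: r_def s_def field_simps)
  finally show ?case by (simp add: a_def r_def)
qed

lemma convergent_sqrt_iter:
  fixes x :: "'a::{real_normed_algebra,banach}"
  assumes "norm x \<le> 1" shows "convergent (sqrt_iter x)"
proof -
  have mono: "incseq (sqrt_iter (1::real))"
  proof (rule incseq_SucI)
    fix n show "sqrt_iter (1::real) n \<le> sqrt_iter 1 (Suc n)"
      using norm_sqrt_iter_diff_le[of "1::real" n] norm_ge_zero order_trans by fastforce
  qed
  obtain L where "sqrt_iter (1::real) \<longlonglongrightarrow> L"
    by (rule incseq_convergent[OF mono, of 1]) (use sqrt_iter_one_bounds in auto)
  then have "summable (\<lambda>n. sqrt_iter (1::real) (Suc n) - sqrt_iter 1 n)"
    using telescope_sums sums_summable by blast
  then have "summable (\<lambda>n. sqrt_iter x (Suc n) - sqrt_iter x n)"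
    using norm_sqrt_iter_diff_le[OF assms] by (rule summable_comparison_test')
  then have "convergent (\<lambda>n. \<Sum>i<n. sqrt_iter x (Suc i) - sqrt_iter x i)"
    by (simp only: summable_iff_convergent)
  then show ?thesis by (simp add: sum_lessThan_telescope del: sqrt_iter.simps(2))
qed

text \<open>The limit y satisfies 2 y = x + y y, which says that k = 1 - y squares to 1 - x. The
  bound on 1 - k makes k itself positive, and the commutation clause stands in for functional
  calculus.\<close>

lemma exists_sqrt_one_minus:
  fixes x :: "'a::unital_cstar_algebra"
  assumes "norm x \<le> 1" "cstar x = x"
  shows "\<exists>k. cstar k = k \<and> k * k = 1 - x \<and> norm (1 - k) \<le> 1 \<and> (\<forall>b. b * x = x * b \<longrightarrow> b * k = k * b)"
proof -
  obtain y where y: "sqrt_iter x \<longlonglongrightarrow> y"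
    using convergent_sqrt_iter[OF assms(1)] by (auto simp: convergent_def)
  have "(\<lambda>n. sqrt_iter x (Suc n)) \<longlonglongrightarrow> (1/2) *\<^sub>R (x + y * y)"
    unfolding sqrt_iter.simps by (intro tendsto_intros y)
  then have "y = (1/2) *\<^sub>R (x + y * y)"
    using LIMSEQ_Suc[OF y] LIMSEQ_unique by blast
  then have "2 *\<^sub>R y = 2 *\<^sub>R ((1/2) *\<^sub>R (x + y * y))" by simp
  then have yy: "y + y = x + y * y" by (simp add: scaleR_2)
  have "cstar (sqrt_iter x n) = sqrt_iter x n" for n
    by (induction n) (simp_all add: cstar_scaleR cstar_add cstar_mult assms)
  then have "sqrt_iter x \<longlonglongrightarrow> cstar y"
    using bounded_linear.tendsto[OF bounded_linear_cstar y] by simp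
  then have "cstar y = y" using y LIMSEQ_unique by blast
  then have "cstar (1 - y) = 1 - y" by (simp add: cstar_diff)
  moreover have "(1 - y) * (1 - y) = 1 - x"
    using yy by (simp add: algebra_simps)
  moreover have "norm (1 - (1 - y)) \<le> 1"
    using LIMSEQ_le_const2[OF tendsto_norm[OF y]] norm_sqrt_iter_le[OF assms(1)]
      sqrt_iter_one_bounds order_trans by auto blast
  moreover have "b * (1 - y) = (1 - y) * b" if "b * x = x * b" for b
  proof -
    have "(\<lambda>n. b * sqrt_iter x n) \<longlonglongrightarrow> b * y" by (intro tendsto_intros y)
    moreover have "(\<lambda>n. b * sqrt_iter x n) \<longlonglongrightarrow> y * b"
      unfolding commute_sqrt_iter[OF that] by (intro tendsto_intros y)
    ultimately have "b * y = y * b" using LIMSEQ_unique by blast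
    then show ?thesis by (simp add: algebra_simps)
  qed
  ultimately show ?thesis by blast
qed

section \<open>The order of the algebra without spectral theory\<close>

text \<open>With \<open>u = k + i m\<close> one has \<open>u\<^sup>* u = k\<^sup>2 + m\<^sup>2\<close> and \<open>k = (u + u\<^sup>*) / 2\<close>.\<close>

lemma norm_square_le_norm_sum_squares:
  fixes k m :: "'a::unital_cstar_algebra"
  assumes "cstar k = k" "cstar m = m" "k * m = m * k"
  shows "norm (k * k) \<le> norm (k * k + m * m)"
proof -
  define u where "u = k + \<i> *\<^sub>C m"
  have su: "cstar u = k - \<i> *\<^sub>C m" by (simp add: u_def cstar_add cstar_scaleC assms
      scaleC_minus_left)
  have "cstar u * u = k * k + m * m"
    unfolding su unfolding u_def
    by (simp add: algebra_simps mult_scaleC_left mult_scaleC_right scaleC_add_right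
        scaleC_diff_right scaleC_i_i assms)
  then have nu: "(norm u)\<^sup>2 = norm (k * k + m * m)" by (metis cstar_identity)
  have "k + k = u + cstar u" unfolding su by (simp add: u_def)
  then have "norm (2 *\<^sub>R k) \<le> norm u + norm (cstar u)" by (metis scaleR_2 norm_triangle_ineq)
  then have "norm k \<le> norm u" by simp
  moreover have "norm (k * k) = (norm k)\<^sup>2" using cstar_identity[of k] assms by simp
  ultimately show ?thesis using nu by (metis norm_ge_zero power_mono)
qed

text \<open>The condition \<open>norm (t - h) \<le> t\<close> says that the spectrum of \<open>h\<close> is non-negative; in this
  form it is visibly stable under sums, and no spectral theory is needed.\<close>

definition cpos :: "'a::unital_cstar_algebra \<Rightarrow> bool" where
  "cpos h \<longleftrightarrow> cstar h = h \<and> (\<exists>t\<ge>0. norm (t *\<^sub>R 1 - h) \<le> t)"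

lemma cposD: "cpos h \<Longrightarrow> cstar h = h"
  by (simp add: cpos_def)

lemma cposI: "cstar h = h \<Longrightarrow> t \<ge> 0 \<Longrightarrow> norm (t *\<^sub>R 1 - h) \<le> t \<Longrightarrow> cpos h"
  by (auto simp: cpos_def)

lemma cpos_zero [simp]: "cpos 0"
  by (rule cposI[of _ 0]) auto

lemma cpos_one [simp]: "cpos 1"
  by (rule cposI[of _ 1]) auto

lemma cpos_add:
  assumes "cpos h" "cpos k" shows "cpos (h + k)"
proof -
  obtain s t where st: "s \<ge> 0" "t \<ge> 0" "norm (s *\<^sub>R 1 - h) \<le> s" "norm (t *\<^sub>R 1 - k) \<le> t"
    using assms by (auto simp: cpos_def)
  have "norm ((s + t) *\<^sub>R 1 - (h + k)) = norm ((s *\<^sub>R 1 - h) + (t *\<^sub>R 1 - k))"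
    by (simp add: algebra_simps)
  also have "\<dots> \<le> s + t" using st by (intro norm_triangle_le) simp
  finally show ?thesis using st assms by (intro cposI[of _ "s + t"]) (auto simp: cstar_add cposD)
qed

lemma cpos_scaleR:
  assumes "cpos h" "r \<ge> 0" shows "cpos (r *\<^sub>R h)"
proof -
  obtain t where t: "t \<ge> 0" "norm (t *\<^sub>R 1 - h) \<le> t" using assms by (auto simp: cpos_def)
  have "norm ((r * t) *\<^sub>R 1 - r *\<^sub>R h) = r * norm (t *\<^sub>R 1 - h)"
    using assms(2) by (metis norm_scaleR abs_of_nonneg scaleR_right_diff_distrib scaleR_scaleR)
  with t assms show ?thesis
    by (intro cposI[of _ "r * t"]) (auto simp: cstar_scaleR cposD mult_left_mono)
qed

lemma cpos_sum: "(\<And>i. i \<in> I \<Longrightarrow> cpos (f i)) \<Longrightarrow> cpos (sum f I)"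
  by (induction I rule: infinite_finite_induct) (auto intro: cpos_add)

text \<open>Division by the witness t puts h in the form t (1 - x) with x of norm at most 1, so the
  root is sqrt t times the root of 1 - x. The witness t = 0 forces h = 0.\<close>

lemma cpos_sqrt:
  assumes "cpos h"
  shows "\<exists>k. cstar k = k \<and> k * k = h \<and> cpos k \<and> (\<forall>b. b * h = h * b \<longrightarrow> b * k = k * b)"
proof -
  obtain t where t: "t \<ge> 0" "norm (t *\<^sub>R 1 - h) \<le> t" using assms by (auto simp: cpos_def)
  show ?thesis
  proof (cases "t = 0")
    case True
    then show ?thesis using t by (intro exI[of _ 0]) simp
  next
    case False
    define x where "x = 1 - (1/t) *\<^sub>R h"
    have "x = (1/t) *\<^sub>R (t *\<^sub>R 1 - h)" using False by (simp add: x_def scaleR_right_diff_distrib)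
    then have "norm x \<le> 1" using t False by (simp add: divide_le_eq)
    moreover have "cstar x = x" using assms by (simp add: x_def cstar_diff cstar_scaleR cposD)
    ultimately obtain k where k: "cstar k = k" "k * k = 1 - x" "norm (1 - k) \<le> 1"
      and comm: "\<And>b. b * x = x * b \<Longrightarrow> b * k = k * b"
      using exists_sqrt_one_minus by blast
    show ?thesis
    proof (intro exI[of _ "sqrt t *\<^sub>R k"] conjI allI impI)
      show "sqrt t *\<^sub>R k * sqrt t *\<^sub>R k = h" using t(1) False k(2) by (simp add: x_def)
      have "cpos k" using k by (intro cposI[of _ 1]) auto
      then show "cpos (sqrt t *\<^sub>R k)" using t(1) by (intro cpos_scaleR) auto
      show "b * sqrt t *\<^sub>R k = sqrt t *\<^sub>R k * b" if "b * h = h * b" for b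
        using comm[of b] that by (simp add: x_def algebra_simps)
    qed (simp add: cstar_scaleR k)
  qed
qed

lemma cpos_norm_minus: "cstar a = a \<Longrightarrow> norm a \<le> t \<Longrightarrow> cpos (t *\<^sub>R 1 - a)"
  using order_trans[OF norm_ge_zero[of a]]
  by (intro cposI[of _ t]) (auto simp: cstar_diff cstar_scaleR)

lemma norm_selfadjoint_square: "cstar a = a \<Longrightarrow> norm (a * a) = (norm a)\<^sup>2"
  using cstar_identity[of a] by simp

text \<open>For t = norm (a a) the element t - a a has a root m commuting with a. Since m m + a a =
  t, the norm of m m is at most t, and this is the criterion for a a with witness t.\<close>

lemma cpos_square:
  assumes "cstar a = a" shows "cpos (a * a)"
proof -
  define t where "t = norm (a * a)"
  have sa: "cstar (a * a) = a * a" by (simp add: cstar_mult assms)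
  then have "cpos (t *\<^sub>R 1 - a * a)" by (rule cpos_norm_minus) (simp add: t_def)
  then obtain m where m: "cstar m = m" "m * m = t *\<^sub>R 1 - a * a"
    and comm: "\<And>b. b * (t *\<^sub>R 1 - a * a) = (t *\<^sub>R 1 - a * a) * b \<Longrightarrow> b * m = m * b"
    using cpos_sqrt by blast
  have "a * m = m * a" by (rule comm) (simp add: algebra_simps)
  then have "norm (m * m) \<le> norm (m * m + a * a)"
    using m assms by (intro norm_square_le_norm_sum_squares) auto
  also have "\<dots> \<le> t" unfolding m using norm_scaleR_one_le[of t] by (simp add: t_def)
  finally show ?thesis using sa m by (intro cposI[of _ t]) (auto simp: t_def)
qed

text \<open>Roots of commuting positive elements commute, so their product is self-adjoint and its
  square is a b.\<close>

lemma cpos_mult: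
  assumes "cpos a" "cpos b" "a * b = b * a" shows "cpos (a * b)"
proof -
  obtain k where k: "cstar k = k" "k * k = a" "\<And>c. c * a = a * c \<Longrightarrow> c * k = k * c"
    using cpos_sqrt[OF assms(1)] by blast
  obtain l where l: "cstar l = l" "l * l = b" "\<And>c. c * b = b * c \<Longrightarrow> c * l = l * c"
    using cpos_sqrt[OF assms(2)] by blast
  have "b * k = k * b" using k(3) assms(3) by simp
  then have kl: "k * l = l * k" using l(3)[of k] by simp
  have "a * b = (k * l) * (k * l)"
    using arg_cong[OF kl, of "\<lambda>c. k * c * l"] by (simp add: mult.assoc flip: k(2) l(2))
  moreover have "cstar (k * l) = k * l" using k(1) l(1) kl by (simp add: cstar_mult)
  ultimately show ?thesis using cpos_square[of "k * l"] by simp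
qed

text \<open>For t = norm q both p and t - p = (t - q) + (q - p) are positive. They are squares of
  commuting self-adjoint elements with sum t, so neither norm exceeds t.\<close>

lemma norm_mono_cpos:
  assumes "cpos p" "cpos (q - p)" shows "norm p \<le> norm q"
proof -
  define t where "t = norm q"
  have "cstar q = q" using cposD[OF assms(1)] cposD[OF assms(2)] by (simp add: cstar_diff)
  then have "cpos ((t *\<^sub>R 1 - q) + (q - p))"
    by (intro cpos_add assms(2) cpos_norm_minus) (auto simp: t_def)
  then have "cpos (t *\<^sub>R 1 - p)" by simp
  then obtain m where m: "cstar m = m" "m * m = t *\<^sub>R 1 - p"
    and comm: "\<And>b. b * (t *\<^sub>R 1 - p) = (t *\<^sub>R 1 - p) * b \<Longrightarrow> b * m = m * b"
    using cpos_sqrt by blast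
  obtain k where k: "cstar k = k" "k * k = p"
    using cpos_sqrt[OF assms(1)] by blast
  have "k * p = p * k" by (metis k(2) mult.assoc)
  then have "k * m = m * k" by (intro comm) (simp add: algebra_simps)
  then have "norm (k * k) \<le> norm (k * k + m * m)"
    using k m by (intro norm_square_le_norm_sum_squares) auto
  also have "\<dots> \<le> t" unfolding m k using norm_scaleR_one_le[of t] by (simp add: t_def)
  finally show ?thesis using k t_def by simp
qed

text \<open>Bernoulli's inequality: the remainder at \<open>Suc m\<close> is 1 + p times the
  remainder at \<open>m\<close>, plus m p p. Everything commutes, so positivity survives the
  products.\<close>

lemma cpos_bernoulli:
  assumes "cpos p" shows "cpos ((1 + p) ^ m - 1 - real m *\<^sub>R p)"
proof (induction m)
  case (Suc m)
  let ?r = "(1 + p) ^ m - 1 - real m *\<^sub>R p"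
  have comm: "(1 + p) * (1 + p) ^ m = (1 + p) ^ m * (1 + p)" by (simp only: power_commutes)
  then have pc: "p * (1 + p) ^ m = (1 + p) ^ m * p" by (simp add: algebra_simps)
  have "cpos ((1 + p) * ?r)"
    using assms Suc pc by (intro cpos_mult cpos_add) (auto simp: algebra_simps)
  moreover have "cpos (real m *\<^sub>R (p * p))"
    using cpos_mult[OF assms assms] by (intro cpos_scaleR) auto
  moreover have "(1 + p) ^ Suc m - 1 - real (Suc m) *\<^sub>R p = (1 + p) * ?r + real m *\<^sub>R (p * p)"
    by (simp add: algebra_simps)
  ultimately show ?case using cpos_add by metis
qed simp

text \<open>From \<open>c n = - p c\<close> with \<open>n = - c\<^sup>* c\<close> and \<open>p = c c\<^sup>*\<close> one gets
  \<open>c (1 - n)\<^sup>m = (1 + p)\<^sup>m c\<close>; the left side is bounded in \<open>m\<close>, while the square of the norm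
  of the right side is at least \<open>2 m \<parallel>p\<^sup>2\<parallel>\<close>.\<close>

lemma eq_zero_if_cpos_both_signs_normalized:
  assumes p: "cpos (c * cstar c)" and n: "norm (1 + cstar c * c) \<le> 1"
  shows "c = 0"
proof -
  define p where "p = c * cstar c"
  define q where "q = 1 + cstar c * c"
  have pp: "cpos p" using p by (simp add: p_def)
  have pow: "(1 + p) ^ m * c = c * q ^ m" for m
  proof (induction m)
    case (Suc m)
    have "(1 + p) ^ Suc m * c = (1 + p) * (c * q ^ m)" by (simp add: mult.assoc Suc)
    also have "\<dots> = c * q * q ^ m" by (simp add: p_def q_def algebra_simps)
    finally show ?case by (simp add: mult.assoc)
  qed simp
  have bound: "2 * real m * norm (p * p) \<le> (norm c)\<^sup>2" for m
  proof -
    let ?y = "(1 + p) ^ m * c"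
    let ?z = "(1 + p) ^ (m + m)"
    have comm: "p * (1 + p) ^ k = (1 + p) ^ k * p" for k
      using power_commutes[of "1 + p" k] by (simp add: algebra_simps)
    have "cstar ((1 + p) ^ m) = (1 + p) ^ m" using pp by (simp add: cstar_power cstar_add cposD)
    then have "?y * cstar ?y = (1 + p) ^ m * p * (1 + p) ^ m"
      by (simp add: cstar_mult p_def mult.assoc)
    also have "\<dots> = p * ?z" by (metis comm mult.assoc power_add)
    finally have eq: "(norm ?y)\<^sup>2 = norm (p * ?z)" by (metis norm_mult_cstar)
    have "norm ?y \<le> norm c * norm (q ^ m)" unfolding pow by (rule norm_mult_ineq)
    also have "\<dots> \<le> norm c"
      using norm_power_le[of q m] n by (simp add: q_def mult_left_le)
    finally have le: "norm (p * ?z) \<le> (norm c)\<^sup>2"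
      unfolding eq[symmetric] by (intro power_mono) auto
    \<comment> \<open>Bernoulli for the exponent 2 m, multiplied by p; the added p cancels the term
      coming from - 1.\<close>
    have "cpos (p * (?z - 1 - real (m + m) *\<^sub>R p) + p)"
      using cpos_bernoulli[OF pp, of "m + m"] pp comm[of "m + m"]
      by (intro cpos_add cpos_mult) (auto simp: algebra_simps)
    then have "cpos (p * ?z - real (m + m) *\<^sub>R (p * p))" by (simp add: algebra_simps)
    then have "norm (real (m + m) *\<^sub>R (p * p)) \<le> norm (p * ?z)"
      by (intro norm_mono_cpos cpos_scaleR cpos_mult pp) auto
    with le show ?thesis by simp
  qed
  have "norm (p * p) = 0"
  proof (rule ccontr)
    assume "norm (p * p) \<noteq> 0"
    then have pos: "norm (p * p) > 0" by simp
    obtain m :: nat where "(norm c)\<^sup>2 / norm (p * p) < real m" using reals_Archimedean2 by blast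
    then have "(norm c)\<^sup>2 < real m * norm (p * p)" using pos by (simp add: divide_less_eq)
    moreover have "real m * norm (p * p) \<le> 2 * real m * norm (p * p)" by simp
    ultimately show False using bound[of m] by linarith
  qed
  then have "norm p = 0" using norm_selfadjoint_square[of p] pp by (simp add: cposD)
  then show "c = 0" using norm_mult_cstar[of c] by (simp add: p_def)
qed

text \<open>This replaces the fact that \<open>cstar c * c\<close> and \<open>c * cstar c\<close>
  have the same nonzero spectrum. Dividing c by sqrt t normalizes the witness t to 1; for t = 0 the
  C*-identity gives c = 0 at once.\<close>

lemma eq_zero_if_cpos_both_signs:
  assumes p: "cpos (c * cstar c)" and n: "cpos (- (cstar c * c))"
  shows "c = 0"
proof -
  obtain t where t: "t \<ge> 0" "norm (t *\<^sub>R 1 + cstar c * c) \<le> t"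
    using n by (auto simp: cpos_def)
  show ?thesis
  proof (cases "t = 0")
    case True
    then have "norm (cstar c * c) = 0" using t by simp
    then show ?thesis by (simp add: cstar_identity)
  next
    case False
    define d where "d = (1 / sqrt t) *\<^sub>R c"
    have "1 + cstar d * d = (1/t) *\<^sub>R (t *\<^sub>R 1 + cstar c * c)"
      using False t(1) by (simp add: d_def cstar_scaleR scaleR_right_distrib)
    then have "norm (1 + cstar d * d) \<le> 1" using False t by (simp add: divide_le_eq)
    moreover have "cpos (d * cstar d)"
      using p t(1) by (simp add: d_def cstar_scaleR cpos_scaleR)
    ultimately have "d = 0" by (intro eq_zero_if_cpos_both_signs_normalized)
    then show ?thesis using False t(1) by (simp add: d_def)
  qed
qed

text \<open>Up to a scalar this is the sum of the squares of the real and imaginary parts of c: a is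
  twice the real part, b is minus twice the imaginary part.\<close>

lemma cpos_add_commuted:
  "cpos (cstar c * c + c * cstar (c::'a::unital_cstar_algebra))"
proof -
  define a b where "a = c + cstar c" and "b = \<i> *\<^sub>C (c - cstar c)"
  have "cstar b = b"
    by (simp add: b_def cstar_scaleC cstar_diff cstar_cstar scaleC_minus_left scaleC_diff_right)
  then have "cpos (b * b)" by (rule cpos_square)
  moreover have "cpos (a * a)"
    by (rule cpos_square) (simp add: a_def cstar_add cstar_cstar add.commute)
  ultimately have "cpos ((1/2) *\<^sub>R (a * a + b * b))" by (intro cpos_scaleR cpos_add) auto
  also have "a * a + b * b = 2 *\<^sub>R (cstar c * c + c * cstar c)"
    by (simp add: a_def b_def mult_scaleC_left mult_scaleC_right scaleC_i_i scaleC_diff_right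
        scaleR_2 algebra_simps)
  finally show ?thesis by simp
qed

text \<open>Kaplansky's argument: for \<open>h = b\<^sup>* b\<close> and \<open>m = \<bar>h\<bar> - h\<close> the element
  \<open>c = b m\<close> satisfies \<open>c\<^sup>* c = m h m = - m \<bar>h\<bar> m\<close>.\<close>

lemma cpos_cstar_mult: "cpos (cstar b * b)"
proof -
  define h where "h = cstar b * b"
  have sh: "cstar h = h" by (simp add: h_def cstar_mult cstar_cstar)
  obtain r where "cstar r = r \<and> r * r = h * h \<and> cpos r \<and>
      (\<forall>c. c * (h * h) = h * h * c \<longrightarrow> c * r = r * c)"
    using cpos_sqrt[OF cpos_square[OF sh]] by (rule exE)
  then have r: "cstar r = r" "r * r = h * h" "cpos r" and hr: "h * r = r * h"
    by (auto simp only: mult.assoc)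
  define m where "m = r - h"
  have sm: "cstar m = m" by (simp add: m_def cstar_diff r sh)
  have mr: "m * r = r * m" using hr by (simp add: m_def algebra_simps)
  have hm: "h * m = - (r * m)" using hr r(2) by (simp add: m_def algebra_simps)
  have "m * h = - (r * m)" using hr r(2) by (simp add: m_def algebra_simps)
  then have hm_m: "m * (h * m) = - (r * (m * m))" by (simp flip: mult.assoc)
  define c where "c = b * m"
  have "cstar c * c = (m * h) * m"
    by (simp add: c_def h_def cstar_mult sm mult.assoc)
  also have "\<dots> = - (r * (m * m))" by (simp add: hm_m mult.assoc)
  finally have cc: "cstar c * c = - (r * (m * m))" .
  have pos: "cpos (r * (m * m))"
    using mr by (intro cpos_mult cpos_square r sm) (simp add: mult.assoc, simp flip: mult.assoc)
  \<comment> \<open>The added term is the negative of \<open>cstar c * c\<close>, so only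
    \<open>c * cstar c\<close> is left and c has products of both signs.\<close>
  then have "cpos ((cstar c * c + c * cstar c) + r * (m * m))"
    by (intro cpos_add cpos_add_commuted)
  then have "cpos (c * cstar c)" by (simp add: cc)
  then have "c = 0" using pos by (intro eq_zero_if_cpos_both_signs) (simp_all add: cc)
  \<comment> \<open>Now r m m and h m m both vanish, hence so does the cube of m = r - h. For
    self-adjoint m this forces m = 0, so h equals its positive absolute value r.\<close>
  then have rmm: "r * (m * m) = 0" using cc by simp
  moreover have "h * (m * m) = - (r * (m * m))" by (simp add: hm flip: mult.assoc)
  ultimately have "(r - h) * (m * m) = 0" by (simp add: left_diff_distrib)
  then have "m * (m * m) = 0" by (simp add: m_def)
  then have "(m * m) * (m * m) = 0" by (simp add: mult.assoc)
  then have "norm (m * m) = 0"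
    using norm_selfadjoint_square[of "m * m"] by (simp add: cstar_mult sm)
  then have "m = 0" using norm_selfadjoint_square[OF sm] by simp
  then show ?thesis using r by (simp add: m_def h_def)
qed

text \<open>With p = k k the element is \<open>cstar (k * a) * (k * a)\<close>. As a and p need not
  commute, this rests on \<open>cpos_cstar_mult\<close> rather than on
  \<open>cpos_mult\<close>.\<close>

lemma cpos_conjugate:
  assumes "cpos p" shows "cpos (cstar a * p * a)"
proof -
  obtain k where "cstar k = k" "k * k = p" using cpos_sqrt[OF assms] by blast
  then have "cstar a * p * a = cstar (k * a) * (k * a)" by (auto simp: cstar_mult mult.assoc)
  then show ?thesis using cpos_cstar_mult[of "k * a"] by simp
qed

section \<open>The uniform boundedness principle\<close>

text \<open>The closed sets \<open>E k\<close> cover the complete space, so by Baire one of them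
  contains a ball, and linearity spreads the bound on that ball to all vectors.\<close>

lemma uniform_boundedness:
  fixes T :: "nat \<Rightarrow> 'a::banach \<Rightarrow> 'b::real_normed_vector"
  assumes lin: "\<And>n. bounded_linear (T n)" and bdd: "\<And>x. bounded (range (\<lambda>n. T n x))"
  obtains M where "\<And>n x. norm (T n x) \<le> M * norm x"
proof -
  define E where "E k = {x. \<forall>n. norm (T n x) \<le> real k}" for k
  have "closed (E k)" for k
  proof -
    have "E k = (\<Inter>n. {x. norm (T n x) \<le> real k})" by (auto simp: E_def)
    moreover have "closed {x. norm (T n x) \<le> real k}" for n
      by (intro closed_Collect_le continuous_intros linear_continuous_on lin)
    ultimately show ?thesis by auto
  qed
  moreover have "\<Union>(range E) = UNIV"
  proof -
    have "\<exists>k. x \<in> E k" for x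
    proof -
      obtain B where "\<And>n. norm (T n x) \<le> B" using bdd[of x] by (auto simp: bounded_iff)
      moreover obtain k where "B \<le> real k" using real_arch_simple by blast
      ultimately show ?thesis by (auto simp: E_def intro: order_trans)
    qed
    then show ?thesis by blast
  qed
  moreover have "interior (\<Union>(range E)) = {}" if "\<And>k. interior (E k) = {}"
    using Met_TC.metric_Baire_category_alt[of "range E"] that \<open>\<And>k. closed (E k)\<close>
    by (auto simp: complete_UNIV)
  ultimately obtain k where "interior (E k) \<noteq> {}"
    by (metis UNIV_not_empty interior_UNIV)
  then obtain y e where e: "e > 0" "ball y e \<subseteq> E k"
    by (meson all_not_in_conv mem_interior)
  show ?thesis
  proof (rule that)
    fix n x
    interpret T: bounded_linear "T n" by (rule lin)
    \<comment> \<open>Moving from y by r x, of length e/2, stays in the ball. The difference of two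
      values bounded by k gives r norm (T n x) \<le> 2 k with r = e / (2 norm x), hence the constant
      4 k / e.\<close>
    show "norm (T n x) \<le> (4 * real k / e) * norm x"
    proof (cases "x = 0")
      case False
      define r where "r = e / (2 * norm x)"
      have r: "r > 0" using e False by (simp add: r_def)
      have "norm (r *\<^sub>R x) < e" using e False by (simp add: r_def)
      then have "y + r *\<^sub>R x \<in> E k" "y \<in> E k" using e by (auto simp: dist_norm)
      then have "norm (T n (y + r *\<^sub>R x) - T n y) \<le> 2 * real k"
        using norm_triangle_ineq4[of "T n (y + r *\<^sub>R x)" "T n y"] by (auto simp: E_def) (smt (verit))
      then have "r * norm (T n x) \<le> 2 * real k" using r by (simp add: T.add T.scaleR)
      then show ?thesis using e False by (simp add: r_def field_simps)
    qed (simp add: T.zero)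
  qed
qed

section \<open>Inner product calculus and the Cauchy-Schwarz inequality in the order of the
  algebra\<close>

context hilbert_module
begin

lemma ip_add_left: "ip (x + y) z = ip x z + ip y z"
  by (metis cstar_add cstar_ip ip_add_right)

lemma ip_scaleC_left: "ip (c *\<^sub>C x) z = cnj c *\<^sub>C ip x z"
  by (metis cstar_scaleC cstar_ip ip_scaleC_right)

lemma ip_act_left: "ip (act x a) z = cstar a * ip x z"
  by (metis cstar_mult cstar_ip ip_act_right)

lemma ip_scaleR_right: "ip x (r *\<^sub>R y) = r *\<^sub>R ip x y"
  by (simp add: scaleR_scaleC ip_scaleC_right)

lemma ip_scaleR_left: "ip (r *\<^sub>R x) y = r *\<^sub>R ip x y"
  by (simp add: scaleR_scaleC ip_scaleC_left)

lemma ip_zero_right [simp]: "ip x 0 = 0"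
  using ip_add_right[of x 0 0] by simp

lemma ip_zero_left [simp]: "ip 0 x = 0"
  using ip_add_left[of 0 0 x] by simp

lemma ip_diff_right: "ip x (y - z) = ip x y - ip x z"
  using ip_add_right[of x "y - z" z] by simp

lemma ip_diff_left: "ip (x - y) z = ip x z - ip y z"
  using ip_add_left[of "x - y" y z] by simp

lemma ip_sum_right: "ip x (sum f I) = (\<Sum>i\<in>I. ip x (f i))"
  by (induction I rule: infinite_finite_induct) (simp_all add: ip_add_right)

lemma ip_sum_left: "ip (sum f I) x = (\<Sum>i\<in>I. ip (f i) x)"
  by (induction I rule: infinite_finite_induct) (simp_all add: ip_add_left)

lemma act_zero_left [simp]: "act 0 a = 0"
  using act_add_left[of 0 0 a] by simp

lemma act_diff_left: "act (x - y) a = act x a - act y a"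
  using act_add_left[of "x - y" y a] by simp

lemma act_scaleR_left: "act (r *\<^sub>R x) a = r *\<^sub>R act x a"
  by (simp add: scaleR_scaleC act_scaleC_left)

lemma act_scaleR_right: "act x (r *\<^sub>R a) = r *\<^sub>R act x a"
  by (simp add: scaleR_scaleC act_scaleC_right)

lemma act_sum_left: "act (sum f I) a = (\<Sum>i\<in>I. act (f i) a)"
  by (induction I rule: infinite_finite_induct) (simp_all add: act_add_left)

lemma norm_sq: "(norm x)\<^sup>2 = norm (ip x x)"
  by (simp add: norm_ip)

lemma norm_act_le: "norm (act x a) \<le> norm x * norm a"
proof -
  have "(norm (act x a))\<^sup>2 = norm (cstar a * (ip x x * a))"
    by (simp add: norm_sq ip_act_left ip_act_right mult.assoc)
  also have "\<dots> \<le> norm (cstar a) * (norm (ip x x) * norm a)"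
    by (meson norm_mult_ineq mult_left_mono norm_ge_zero order_trans)
  also have "\<dots> = (norm x * norm a)\<^sup>2"
    by (simp add: norm_sq[symmetric] power2_eq_square)
  finally show ?thesis by (rule power2_le_imp_le) simp
qed

lemma cpos_ip: "cpos (ip x x)"
  using ip_positive[of x] cpos_cstar_mult by (auto simp: cstar_positive_def)

lemma cpos_ip_mult: "cpos (ip x s * ip s x)"
  using cpos_cstar_mult[of "ip s x"] by (simp add: cstar_ip)

text \<open>With a = <s, x>, expanding <x - s a, x - s a> gives <x, x> - 2 a* a + a* <s, s> a.
  Adding the positive a* (1 - <s, s>) a leaves the claimed difference.\<close>

lemma cauchy_schwarz_cpos:
  assumes "norm s \<le> 1" shows "cpos (ip x x - ip x s * ip s x)"
proof -
  let ?a = "ip s x"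
  have sa: "cstar ?a = ip x s" by (rule cstar_ip)
  have "norm (ip s s) \<le> 1" using assms by (simp add: norm_sq[symmetric] power_le_one)
  then have "cpos (cstar ?a * (1 *\<^sub>R 1 - ip s s) * ?a)"
    by (intro cpos_conjugate cpos_norm_minus cstar_ip)
  then have "cpos (ip (x - act s ?a) (x - act s ?a) + cstar ?a * (1 *\<^sub>R 1 - ip s s) * ?a)"
    by (intro cpos_add cpos_ip)
  then show ?thesis
    by (simp add: ip_diff_left ip_diff_right ip_act_left ip_act_right sa algebra_simps)
qed

lemma norm_ip_le: "norm (ip x y) \<le> norm x * norm y"
proof -
  have unit: "norm (ip s y) \<le> norm y" if "norm s \<le> 1" for s
  proof -
    have "(norm (ip s y))\<^sup>2 = norm (ip y s * ip s y)"
      using cstar_identity[of "ip s y"] by (simp add: cstar_ip)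
    also have "\<dots> \<le> norm (ip y y)"
      using that by (intro norm_mono_cpos cpos_ip_mult cauchy_schwarz_cpos)
    finally show ?thesis using power2_le_imp_le by (auto simp: norm_sq[symmetric])
  qed
  show ?thesis
  proof (cases "x = 0")
    case False
    have "norm (ip ((1 / norm x) *\<^sub>R x) y) \<le> norm y" by (rule unit) (simp add: False)
    then show ?thesis using False by (simp add: ip_scaleR_left field_simps)
  qed simp
qed

lemma bounded_linear_ip_right: "bounded_linear (ip x)"
  by (rule bounded_linear_intro[where K = "norm x"])
    (simp_all add: ip_add_right ip_scaleR_right, metis norm_ip_le mult.commute)

lemma ip_mem_dual_module: "ip x \<in> dual_module act"
  by (simp add: dual_module_def bounded_linear_ip_right ip_act_right)

end

section \<open>Decay estimates for powers of 1 - S\<close>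

text \<open>An \<open>A\<close>-linear operator \<open>0 \<le> S \<le> 1\<close>, abstracted from the frame operators below.\<close>

locale positive_contraction = hilbert_module act ip
  for act :: "'v::complex_banach \<Rightarrow> 'a::unital_cstar_algebra \<Rightarrow> 'v" and ip +
  fixes S :: "'v \<Rightarrow> 'v"
  assumes S_add: "S (x + y) = S x + S y"
    and S_act: "S (act x a) = act (S x) a"
    and S_sym: "ip (S x) y = ip x (S y)"
    and S_pos: "cpos (ip x (S x))"
    and S_le: "cpos (ip x x - ip x (S x))"
begin

definition D :: "'v \<Rightarrow> 'v" where "D x = x - S x"

lemma S_diff: "S (x - y) = S x - S y"
  using S_add[of "x - y" y] by simp

lemma Dpow_add: "(D ^^ n) (x + y) = (D ^^ n) x + (D ^^ n) y"
  by (induction n) (simp_all add: D_def S_add)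

lemma Dpow_act: "(D ^^ n) (act x a) = act ((D ^^ n) x) a"
  by (induction n) (simp_all add: D_def S_act act_diff_left)

lemma Dpow_sym: "ip ((D ^^ n) x) y = ip x ((D ^^ n) y)"
proof (induction n arbitrary: y)
  case (Suc n)
  have "ip (D z) y = ip z (D y)" for z by (simp add: D_def ip_diff_left ip_diff_right S_sym)
  then show ?case using Suc by simp (simp add: funpow_swap1)
qed simp

text \<open>In operator form S - D S D = S S + S (1 - S) S, and both terms are positive by
  hypothesis on S.\<close>

lemma cpos_decrease: "cpos (ip y (S y) - ip (D y) (S (D y)))"
proof -
  have "cpos (ip (S y) (S y) + (ip (S y) (S y) - ip (S y) (S (S y))))"
    by (intro cpos_add cpos_ip S_le)
  then show ?thesis
    by (simp add: D_def S_diff ip_diff_left ip_diff_right S_sym algebra_simps)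
qed

text \<open>In operator form 1 - D D - S = S - S S. Writing this as D S D + S (1 - S) S exhibits its
  positivity without a square root of the operator S.\<close>

lemma cpos_telescope: "cpos (ip y y - ip (D y) (D y) - ip y (S y))"
proof -
  have "cpos (ip (D y) (S (D y)) + (ip (S y) (S y) - ip (S y) (S (S y))))"
    by (intro cpos_add S_pos S_le)
  then show ?thesis
    by (simp add: D_def S_diff ip_diff_left ip_diff_right S_sym algebra_simps)
qed

text \<open>The elements \<open>\<langle>D\<^sup>k y, S (D\<^sup>k y)\<rangle>\<close> decrease in \<open>k\<close>, and each is at most
  \<open>\<langle>D\<^sup>k y, D\<^sup>k y\<rangle> - \<langle>D\<^sup>k\<^sup>+\<^sup>1 y, D\<^sup>k\<^sup>+\<^sup>1 y\<rangle>\<close>; these differences telescope.\<close>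

lemma cpos_Dpow:
  "cpos (ip y y - ip ((D ^^ n) y) ((D ^^ n) y) - real n *\<^sub>R ip ((D ^^ n) y) (S ((D ^^ n) y)))"
proof (induction n)
  case (Suc n)
  define z where "z = (D ^^ n) y"
  \<comment> \<open>The factor \<open>Suc n\<close> trades all n + 1 copies of <z, S z>, n from the
    induction hypothesis and one from the telescoping term, for copies of <D z, S (D z)>.\<close>
  have "cpos ((ip y y - ip z z - real n *\<^sub>R ip z (S z)) + (ip z z - ip (D z) (D z) - ip z (S z))
      + real (Suc n) *\<^sub>R (ip z (S z) - ip (D z) (S (D z))))"
    using Suc by (intro cpos_add cpos_scaleR cpos_telescope cpos_decrease) (auto simp: z_def)
  then show ?case
    by (simp add: z_def[symmetric] algebra_simps)
qed simp

lemma norm_Dpow_le: "norm ((D ^^ n) y) \<le> norm y"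
proof -
  let ?z = "(D ^^ n) y"
  have "cpos ((ip y y - ip ?z ?z - real n *\<^sub>R ip ?z (S ?z)) + real n *\<^sub>R ip ?z (S ?z))"
    by (intro cpos_add cpos_scaleR cpos_Dpow S_pos) auto
  then have "norm (ip ?z ?z) \<le> norm (ip y y)"
    by (intro norm_mono_cpos cpos_ip) simp
  then show ?thesis by (simp add: norm_sq[symmetric])
qed

text \<open>D^n y itself need not become small, for instance when S y = 0. What decays like 1/n,
  whatever S is, is the part of it that S sees.\<close>

lemma norm_ip_S_Dpow_le: "real n * norm (ip ((D ^^ n) y) (S ((D ^^ n) y))) \<le> (norm y)\<^sup>2"
proof -
  let ?z = "(D ^^ n) y"
  have "cpos ((ip y y - ip ?z ?z - real n *\<^sub>R ip ?z (S ?z)) + ip ?z ?z)"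
    by (intro cpos_add cpos_Dpow cpos_ip)
  then have "norm (real n *\<^sub>R ip ?z (S ?z)) \<le> norm (ip y y)"
    by (intro norm_mono_cpos cpos_scaleR S_pos) (auto simp: algebra_simps)
  then show ?thesis by (simp add: norm_sq)
qed

end

section \<open>Frame operators and approximation of functionals by inner products\<close>

context hilbert_module
begin

definition frame_op :: "(nat \<Rightarrow> 'v) \<Rightarrow> nat \<Rightarrow> 'v \<Rightarrow> 'v" where
  "frame_op t N x = (1 / real N) *\<^sub>R (\<Sum>i<N. act (t i) (ip (t i) x))"

lemma ip_frame_op:
  "ip x (frame_op t N y) = (1 / real N) *\<^sub>R (\<Sum>i<N. ip x (t i) * ip (t i) y)"
  by (simp add: frame_op_def ip_scaleR_right ip_sum_right ip_act_right)

text \<open>The upper bound S \<le> 1 is the average of N Cauchy-Schwarz inequalities, one for each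
  t_i. For N = 0 the operator is zero.\<close>

lemma positive_contraction_frame_op:
  assumes t: "\<And>i. norm (t i) \<le> 1"
  shows "positive_contraction act ip (frame_op t N)"
proof
  fix x y a
  show "frame_op t N (x + y) = frame_op t N x + frame_op t N y"
    by (simp add: frame_op_def ip_add_right act_add_right sum.distrib scaleR_right_distrib)
  show "frame_op t N (act x a) = act (frame_op t N x) a"
    by (simp add: frame_op_def ip_act_right act_act act_scaleR_left act_sum_left)
  show "ip (frame_op t N x) y = ip x (frame_op t N y)"
    by (simp add: ip_frame_op)
      (simp add: frame_op_def ip_scaleR_left ip_sum_left ip_act_left cstar_ip)
  show "cpos (ip x (frame_op t N x))"
    by (simp add: ip_frame_op cpos_scaleR cpos_sum cpos_ip_mult)
  show "cpos (ip x x - ip x (frame_op t N x))"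
  proof (cases "N = 0")
    case False
    have "cpos ((1 / real N) *\<^sub>R (\<Sum>i<N. ip x x - ip x (t i) * ip (t i) x))"
      by (intro cpos_scaleR cpos_sum cauchy_schwarz_cpos t) simp
    also have "(1 / real N) *\<^sub>R (\<Sum>i<N. ip x x - ip x (t i) * ip (t i) x) = ip x x - ip x (frame_op t N x)"
      using False by (simp add: ip_frame_op sum_subtractf scaleR_right_diff_distrib sum_constant_scaleR)
    finally show ?thesis .
  qed (simp add: ip_frame_op cpos_ip)
qed

text \<open>The error operator 1 - T left by the approximation. The number N of generators and the
  exponent n stay independent until the rate is known.\<close>

definition residual :: "(nat \<Rightarrow> 'v) \<Rightarrow> nat \<Rightarrow> nat \<Rightarrow> 'v \<Rightarrow> 'v" where
  "residual t N n = (\<lambda>x. x - frame_op t N x) ^^ n"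

text \<open>For x = D^n t_i and z = D^n x, symmetry gives <x, x> = <t_i, z>, and <z, t_i> <t_i, z>
  is one summand of N <z, S z>, which is of order N/n. Squaring the norm twice accounts for the
  fourth power.\<close>

lemma norm_residual_generator:
  assumes t: "\<And>i. norm (t i) \<le> 1" and i: "i < N"
  shows "real n * norm (residual t N n (t i)) ^ 4 \<le> real N"
proof -
  interpret positive_contraction act ip "frame_op t N"
    using t by (rule positive_contraction_frame_op)
  have D: "residual t N n = D ^^ n" by (simp add: residual_def D_def[abs_def])
  define x where "x = (D ^^ n) (t i)"
  define z where "z = (D ^^ n) x"
  have nx: "norm x \<le> 1" using norm_Dpow_le[of n "t i"] t[of i] by (simp add: x_def)
  have "norm x ^ 4 = ((norm x)\<^sup>2)\<^sup>2" by simp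
  also have "(norm x)\<^sup>2 = norm (ip (t i) z)"
    unfolding norm_sq by (simp add: z_def x_def Dpow_sym)
  also have "(norm (ip (t i) z))\<^sup>2 = norm (ip z (t i) * ip (t i) z)"
    using cstar_identity[of "ip (t i) z"] by (simp add: cstar_ip)
  also have "\<dots> \<le> norm (real N *\<^sub>R ip z (frame_op t N z))"
  proof (rule norm_mono_cpos[OF cpos_ip_mult])
    \<comment> \<open>The difference consists of the summands with j other than i, each of them
      positive.\<close>
    have "cpos (\<Sum>j\<in>{..<N} - {i}. ip z (t j) * ip (t j) z)"
      by (intro cpos_sum cpos_ip_mult)
    also have "\<dots> = real N *\<^sub>R ip z (frame_op t N z) - ip z (t i) * ip (t i) z"
      using i by (simp add: ip_frame_op sum_diff1)
    finally show "cpos (real N *\<^sub>R ip z (frame_op t N z) - ip z (t i) * ip (t i) z)" .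
  qed
  finally have "real n * norm x ^ 4 \<le> real n * norm (real N *\<^sub>R ip z (frame_op t N z))"
    by (rule mult_left_mono) simp
  also have "\<dots> = real N * (real n * norm (ip z (frame_op t N z)))" by simp
  also have "\<dots> \<le> real N * (norm x)\<^sup>2"
    unfolding z_def by (intro mult_left_mono norm_ip_S_Dpow_le) simp
  also have "\<dots> \<le> real N" using nx by (simp add: mult_left_le power_le_one)
  finally show ?thesis by (simp add: D x_def)
qed

text \<open>The exponent N N makes the bound on generators 1/N. \<open>A\<close>-linearity carries
  the convergence to finite combinations, and the contraction bound, uniform in N, carries it to
  their closure.\<close>

lemma residual_tendsto_zero:
  assumes t: "\<And>i. norm (t i) \<le> 1"
    and dense: "closure {\<Sum>i<n. act (t i) (a i) | (n :: nat) (a :: nat \<Rightarrow> 'a). True} = UNIV"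
  shows "(\<lambda>N. residual t N (N * N) v) \<longlonglongrightarrow> 0"
proof -
  let ?D = "\<lambda>N. residual t N (N * N)"
  note pc = positive_contraction_frame_op[where t = t, OF t]
  have D: "?D N = (positive_contraction.D (frame_op t N) ^^ (N * N))" for N
    by (simp add: residual_def positive_contraction.D_def[OF pc, abs_def])
  have add: "?D N (x + y) = ?D N x + ?D N y" for N x y
    unfolding D by (rule positive_contraction.Dpow_add[OF pc])
  have act: "?D N (act x a) = act (?D N x) a" for N x a
    unfolding D by (rule positive_contraction.Dpow_act[OF pc])
  have le: "norm (?D N x) \<le> norm x" for N x
    unfolding D by (rule positive_contraction.norm_Dpow_le[OF pc])
  have gen: "(\<lambda>N. ?D N (t i)) \<longlonglongrightarrow> 0" for i
  proof -
    have "\<forall>\<^sub>F N in sequentially. norm (norm (?D N (t i)) ^ 4) \<le> 1 / real N"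
      using eventually_gt_at_top[of i]
    proof eventually_elim
      case (elim N)
      have "real N * (real N * norm (?D N (t i)) ^ 4) \<le> real N * 1"
        using norm_residual_generator[OF t elim, of "N * N"] by (simp add: mult.assoc)
      then show ?case using elim by (simp add: field_simps)
    qed
    then have "(\<lambda>N. norm (?D N (t i)) ^ 4) \<longlonglongrightarrow> 0"
      by (rule Lim_null_comparison) (rule lim_1_over_n)
    then have "(\<lambda>N. root 4 (norm (?D N (t i)) ^ 4)) \<longlonglongrightarrow> root 4 0" by (rule tendsto_real_root)
    then have "(\<lambda>N. norm (?D N (t i))) \<longlonglongrightarrow> 0" by (simp add: real_root_power_cancel)
    then show ?thesis by (rule tendsto_norm_zero_cancel)
  qed
  have "(\<lambda>N. ?D N (act (t i) a)) \<longlonglongrightarrow> 0" for i a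
  proof (rule Lim_null_comparison)
    show "\<forall>\<^sub>F N in sequentially. norm (?D N (act (t i) a)) \<le> norm (?D N (t i)) * norm a"
      by (simp add: act norm_act_le)
    show "(\<lambda>N. norm (?D N (t i)) * norm a) \<longlonglongrightarrow> 0"
      using tendsto_mult_right[OF tendsto_norm_zero[OF gen[of i]], of "norm a"] by simp
  qed
  moreover have "?D N 0 = 0" for N using add[of N 0 0] by simp
  ultimately have span: "(\<lambda>N. ?D N (\<Sum>i<n. act (t i) (a i))) \<longlonglongrightarrow> 0" for n and a :: "nat \<Rightarrow> 'a"
  proof (induction n)
    case (Suc n)
    then show ?case using tendsto_add[OF Suc.IH[OF Suc.prems] Suc.prems(1)[of n "a n"]] by (simp add: add)
  qed simp
  show ?thesis
  proof (rule LIMSEQ_I)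
    fix e :: real assume e: "e > 0"
    have "v \<in> closure {\<Sum>i<n. act (t i) (a i) | (n :: nat) (a :: nat \<Rightarrow> 'a). True}"
      using dense by simp
    moreover have "e / 2 > 0" using e by simp
    ultimately obtain w where "w \<in> {\<Sum>i<n. act (t i) (a i) | (n :: nat) (a :: nat \<Rightarrow> 'a). True}"
      and w: "dist w v < e / 2"
      unfolding closure_approachable by blast
    then have "(\<lambda>N. ?D N w) \<longlonglongrightarrow> 0" using span by auto
    then obtain M where M: "\<And>N. N \<ge> M \<Longrightarrow> norm (?D N w) < e / 2"
      using LIMSEQ_D[of _ 0 "e / 2"] e by fastforce
    have "norm (?D N v) < e" if "N \<ge> M" for N
    proof -
      have "norm (?D N v) \<le> norm (?D N (v - w)) + norm (?D N w)"
        using add[of N "v - w" w] norm_triangle_ineq[of "?D N (v - w)" "?D N w"] by simp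
      then show ?thesis using M[OF that] le[of N "v - w"] w
        by (simp add: dist_norm norm_minus_commute)
    qed
    then show "\<exists>no. \<forall>n\<ge>no. norm (?D n v - 0) < e" by auto
  qed
qed

text \<open>From 1 - D^(n+1) = (1 - D^n) D + S, a vector x representing f (1 - D^n) is replaced by D
  x + y, where y represents f S; D is moved to the other side by symmetry.\<close>

lemma dual_module_residual:
  assumes f: "f \<in> dual_module act"
  shows "\<exists>x. \<forall>v. f v - f (residual t N n v) = ip x v"
proof (induction n)
  case 0
  show ?case by (rule exI[of _ 0]) (simp add: residual_def)
next
  case (Suc n)
  interpret f: bounded_linear f using f by (simp add: dual_module_def)
  have fa: "f (act x a) = f x * a" for x a using f by (simp add: dual_module_def)
  obtain x where x: "\<And>v. f v - f (residual t N n v) = ip x v" using Suc by blast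
  define u where "u v = v - frame_op t N v" for v
  define y where "y = (1 / real N) *\<^sub>R (\<Sum>i<N. act (t i) (cstar (f (t i))))"
  have "f v - f (residual t N (Suc n) v) = ip (x - frame_op t N x + y) v" for v
  proof -
    have sym: "ip (frame_op t N x) v = ip x (frame_op t N v)"
      by (simp add: ip_frame_op)
        (simp add: frame_op_def ip_scaleR_left ip_sum_left ip_act_left cstar_ip)
    have y: "f (frame_op t N v) = ip y v"
      by (simp add: frame_op_def y_def f.scaleR f.sum fa ip_scaleR_left ip_sum_left ip_act_left
          cstar_cstar)
    have "residual t N (Suc n) v = residual t N n (v - frame_op t N v)"
      by (simp add: residual_def funpow_Suc_right del: funpow.simps)
    then show ?thesis
      using x[of "v - frame_op t N v"] y
      by (simp add: f.diff ip_diff_right ip_diff_left ip_add_left sym algebra_simps)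
  qed
  then show ?case by blast
qed

lemma dual_module_approximable:
  assumes cg: "countably_generated act" and f: "f \<in> dual_module act"
  obtains x :: "nat \<Rightarrow> 'v" where "\<And>v. (\<lambda>n. ip (x n) v) \<longlonglongrightarrow> f v"
proof -
  obtain s :: "nat \<Rightarrow> 'v" where
    s: "closure {\<Sum>i<n. act (s i) (a i) | (n :: nat) (a :: nat \<Rightarrow> 'a). True} = UNIV"
    using cg by (auto simp: countably_generated_def)
  \<comment> \<open>Rescaling makes the generators contractive without changing their span, since
    the factor is absorbed into the coefficient. The summand 1 in the denominator covers zero
    generators.\<close>
  define t where "t i = (1 / (1 + norm (s i))) *\<^sub>R s i" for i
  have t: "norm (t i) \<le> 1" for i by (auto simp: t_def divide_le_eq add_nonneg_nonneg not_less)
  have st: "s i = (1 + norm (s i)) *\<^sub>R t i" for i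
  proof -
    have "1 + norm (s i) \<noteq> 0" using norm_ge_zero[of "s i"] by linarith
    then show ?thesis by (simp add: t_def)
  qed
  have "{\<Sum>i<n. act (s i) (a i) | (n :: nat) (a :: nat \<Rightarrow> 'a). True} \<subseteq>
      {\<Sum>i<n. act (t i) (a i) | (n :: nat) (a :: nat \<Rightarrow> 'a). True}"
  proof clarify
    fix n :: nat and a :: "nat \<Rightarrow> 'a"
    have "act (s i) (a i) = act (t i) ((1 + norm (s i)) *\<^sub>R a i)" for i
      by (subst st) (simp only: act_scaleR_left act_scaleR_right)
    then have "(\<Sum>i<n. act (s i) (a i)) = (\<Sum>i<n. act (t i) ((1 + norm (s i)) *\<^sub>R a i))" by simp
    then show "\<exists>m b. (\<Sum>i<n. act (s i) (a i)) = (\<Sum>i<m. act (t i) (b i)) \<and> True"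
      by (intro exI[of _ n] exI[of _ "\<lambda>i. (1 + norm (s i)) *\<^sub>R a i"]) simp
  qed
  from closure_mono[OF this]
  have dense: "closure {\<Sum>i<n. act (t i) (a i) | (n :: nat) (a :: nat \<Rightarrow> 'a). True} = UNIV"
    unfolding s by auto
  have "\<forall>N. \<exists>x. \<forall>v. f v - f (residual t N (N * N) v) = ip x v"
    using dual_module_residual[OF f] by blast
  from choice[OF this] obtain x where x: "\<And>N v. f v - f (residual t N (N * N) v) = ip (x N) v"
    by blast
  interpret f: bounded_linear f using f by (simp add: dual_module_def)
  show ?thesis
  proof (rule that)
    fix v
    have "(\<lambda>N. f v - f (residual t N (N * N) v)) \<longlonglongrightarrow> f v - f 0"
      by (intro tendsto_intros f.tendsto residual_tendsto_zero[OF t dense])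
    then show "(\<lambda>n. ip (x n) v) \<longlonglongrightarrow> f v" by (simp add: x f.zero)
  qed
qed

end

section \<open>Convergence and homeomorphisms tested on a subbasis\<close>

text \<open>The filter is arbitrary so that both limits along \<open>sequentially\<close> and Cauchy
  conditions, which use the product filter on pairs of indices, are covered.\<close>

lemma eventually_topology_generated_by:
  assumes "openin (topology_generated_by B) U" "l \<in> U"
    and "\<And>b. b \<in> B \<Longrightarrow> l \<in> b \<Longrightarrow> eventually (\<lambda>i. s i \<in> b) F"
  shows "eventually (\<lambda>i. s i \<in> U) F"
proof -
  have "generate_topology_on B U" using assms(1) by (rule openin_topology_generated_by)
  then show ?thesis using assms(2)
  proof induction
    case (Int a b)
    then show ?case by (auto intro: eventually_conj)
  next
    case (UN K)
    then obtain k where "k \<in> K" "eventually (\<lambda>i. s i \<in> k) F" by blast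
    then show ?case by (auto elim: eventually_mono)
  qed (auto intro: assms(3))
qed

lemma limitin_topology_generated_byI:
  assumes "l \<in> \<Union>B"
    and "\<And>b. b \<in> B \<Longrightarrow> l \<in> b \<Longrightarrow> eventually (\<lambda>i. s i \<in> b) F"
  shows "limitin (topology_generated_by B) s l F"
  using assms eventually_topology_generated_by[of B _ l s F]
  by (auto simp: limitin_def topology_generated_by_topspace)

lemma homeomorphic_map_topology_generated_by:
  assumes bij: "bij_betw \<Phi> (\<Union>B) (\<Union>C)" and C: "C = (\<lambda>b. \<Phi> ` b) ` B"
  shows "homeomorphic_map (topology_generated_by B) (topology_generated_by C) \<Phi>"
proof -
  let ?\<Psi> = "inv_into (\<Union>B) \<Phi>"
  have inj: "inj_on \<Phi> (\<Union>B)" using bij by (rule bij_betw_imp_inj_on)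
  have "continuous_map (topology_generated_by B) (topology_generated_by C) \<Phi>"
  proof (rule continuous_on_generated_topo)
    fix U assume "U \<in> C"
    then obtain b where b: "b \<in> B" "U = \<Phi> ` b" using C by blast
    then have "\<Phi> -` U \<inter> topspace (topology_generated_by B) = b"
      using inj by (auto simp: topology_generated_by_topspace inj_on_def)
    then show "openin (topology_generated_by B) (\<Phi> -` U \<inter> topspace (topology_generated_by B))"
      using b by (simp add: topology_generated_by_Basis)
  qed (use bij_betw_imp_surj_on[OF bij] in \<open>simp add: topology_generated_by_topspace\<close>)
  moreover have "continuous_map (topology_generated_by C) (topology_generated_by B) ?\<Psi>"
  proof (rule continuous_on_generated_topo)
    fix b assume b: "b \<in> B"
    have "?\<Psi> -` b \<inter> \<Union>C = \<Phi> ` b"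
    proof
      show "?\<Psi> -` b \<inter> \<Union>C \<subseteq> \<Phi> ` b"
      proof
        fix y assume y: "y \<in> ?\<Psi> -` b \<inter> \<Union>C"
        then have "y = \<Phi> (?\<Psi> y)" using bij_betw_imp_surj_on[OF bij] by (simp add: f_inv_into_f)
        then show "y \<in> \<Phi> ` b" using y by blast
      qed
      show "\<Phi> ` b \<subseteq> ?\<Psi> -` b \<inter> \<Union>C"
      proof
        fix y assume "y \<in> \<Phi> ` b"
        then obtain x where x: "x \<in> b" "y = \<Phi> x" by blast
        then have "?\<Psi> y = x" using inj b by (auto intro: inv_into_f_f)
        then show "y \<in> ?\<Psi> -` b \<inter> \<Union>C" using x b C by blast
      qed
    qed
    then show "openin (topology_generated_by C) (?\<Psi> -` b \<inter> topspace (topology_generated_by C))"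
      using b C by (simp add: topology_generated_by_topspace topology_generated_by_Basis)
  qed (use bij_betw_imp_surj_on[OF bij_betw_inv_into[OF bij]] in
      \<open>simp add: topology_generated_by_topspace\<close>)
  moreover have "?\<Psi> (\<Phi> x) = x" if "x \<in> \<Union>B" for x
    using inj that by (rule inv_into_f_f)
  moreover have "\<Phi> (?\<Psi> y) = y" if "y \<in> \<Union>C" for y
    using bij that by (rule bij_betw_inv_into_right)
  ultimately have "homeomorphic_maps (topology_generated_by B) (topology_generated_by C) \<Phi> ?\<Psi>"
    by (simp add: homeomorphic_maps_def topology_generated_by_topspace)
  then show ?thesis by (rule homeomorphic_maps_imp_map)
qed

section \<open>The completion and its identification with the dual module\<close>

context hilbert_module
begin

text \<open>This serves twice: it places limits of Cauchy sequences of vectors in the dual module,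
  and it yields completeness of the completion.\<close>

lemma dual_module_limit:
  assumes f: "\<And>n. f n \<in> dual_module act" and lim: "\<And>v. (\<lambda>n. f n v) \<longlonglongrightarrow> g v"
  shows "g \<in> dual_module act"
proof -
  have lin: "bounded_linear (f n)" for n using f by (simp add: dual_module_def)
  have "bounded (range (\<lambda>n. f n x))" for x
    using lim convergent_imp_bounded by blast
  then obtain M where M: "\<And>n x. norm (f n x) \<le> M * norm x"
    using uniform_boundedness[of f] lin by blast
  have "bounded_linear g"
  proof (rule bounded_linear_intro[where K = M])
    fix x y and r :: real
    have "(\<lambda>n. f n (x + y)) \<longlonglongrightarrow> g x + g y"
      using tendsto_add[OF lim lim] by (simp add: linear_simps(1)[OF lin])
    then show "g (x + y) = g x + g y" using lim LIMSEQ_unique by blast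
    have "(\<lambda>n. f n (r *\<^sub>R x)) \<longlonglongrightarrow> r *\<^sub>R g x"
      using tendsto_scaleR[OF tendsto_const lim] by (simp add: linear_simps(5)[OF lin])
    then show "g (r *\<^sub>R x) = r *\<^sub>R g x" using lim LIMSEQ_unique by blast
    show "norm (g x) \<le> norm x * M"
      using LIMSEQ_le_const2[OF tendsto_norm[OF lim]] M by (metis mult.commute)
  qed
  moreover have "g (act x a) = g x * a" for x a
  proof -
    have "(\<lambda>n. f n (act x a)) \<longlonglongrightarrow> g x * a"
      using f tendsto_mult[OF lim tendsto_const] by (simp add: dual_module_def)
    then show ?thesis using lim LIMSEQ_unique by blast
  qed
  ultimately show ?thesis by (simp add: dual_module_def)
qed

text \<open>The involution is isometric, so the variable may change sides in the inner product;
  completeness of the algebra turns Cauchy into convergent.\<close>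

lemma tau_Cauchy_iff: "tau_Cauchy ip x \<longleftrightarrow> (\<forall>v. convergent (\<lambda>n. ip (x n) v))"
proof -
  have "tau_Cauchy ip x \<longleftrightarrow> (\<forall>z. Cauchy (\<lambda>n. ip z (x n)))"
  proof (intro iffI allI)
    fix z assume x: "tau_Cauchy ip x"
    show "Cauchy (\<lambda>n. ip z (x n))"
    proof (rule CauchyI)
      fix e :: real assume e: "e > 0"
      have "openin (tau ip) {y. norm (ip z (y - 0)) < e}"
        unfolding tau_def using e by (intro topology_generated_by_Basis) blast
      with x e show "\<exists>M. \<forall>m\<ge>M. \<forall>n\<ge>M. norm (ip z (x m) - ip z (x n)) < e"
        unfolding tau_Cauchy_def by (fastforce simp: ip_diff_right)
    qed
  next
    assume x: "\<forall>z. Cauchy (\<lambda>n. ip z (x n))"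
    show "tau_Cauchy ip x"
      unfolding tau_Cauchy_def
    proof (intro allI impI)
      fix U assume U: "openin (tau ip) U \<and> 0 \<in> U"
      have "eventually (\<lambda>(m, n). x m - x n \<in> U) (sequentially \<times>\<^sub>F sequentially)"
        unfolding case_prod_beta
      proof (rule eventually_topology_generated_by)
        show "openin (topology_generated_by {{y. norm (ip z (y - x)) < e} | z x e. e > 0}) U" "0 \<in> U"
          using U by (simp_all add: tau_def)
        fix b assume "b \<in> {{y. norm (ip z (y - x)) < e} | z x e. e > 0}" "0 \<in> b"
        then obtain z p e where b: "b = {y. norm (ip z (y - p)) < e}" and p: "norm (ip z p) < e"
          by (auto simp: ip_diff_right)
        \<comment> \<open>A subbasic set may be centred at any p. Containing 0 leaves the margin e -
          norm (ip z p), which the differences must not exceed.\<close>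
        then obtain M where M: "\<And>m n. m \<ge> M \<Longrightarrow> n \<ge> M \<Longrightarrow> norm (ip z (x m) - ip z (x n)) < e - norm (ip z p)"
          using x CauchyD[of "\<lambda>n. ip z (x n)" "e - norm (ip z p)"] by auto
        have "x m - x n \<in> b" if "m \<ge> M" "n \<ge> M" for m n
          using M[OF that] norm_triangle_ineq4[of "ip z (x m) - ip z (x n)" "ip z p"]
          by (simp add: b ip_diff_right)
        then show "eventually (\<lambda>p. x (fst p) - x (snd p) \<in> b) (sequentially \<times>\<^sub>F sequentially)"
          by (auto simp: eventually_prod_sequentially)
      qed
      then show "\<exists>N. \<forall>m\<ge>N. \<forall>n\<ge>N. x m - x n \<in> U"
        by (auto simp: eventually_prod_sequentially)
    qed
  qed
  also have "\<dots> \<longleftrightarrow> (\<forall>v. Cauchy (\<lambda>n. ip (x n) v))"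
  proof -
    have "norm (ip z (x m) - ip z (x n)) = norm (ip (x m) z - ip (x n) z)" for z m n
      by (metis cstar_ip norm_cstar cstar_diff)
    then show ?thesis by (simp add: Cauchy_iff)
  qed
  finally show ?thesis by (simp add: Cauchy_convergent_iff)
qed

definition tau_lim :: "(nat \<Rightarrow> 'v) \<Rightarrow> 'v \<Rightarrow> 'a" where
  "tau_lim x v = lim (\<lambda>n. ip (x n) v)"

lemma tau_lim: "tau_Cauchy ip x \<Longrightarrow> (\<lambda>n. ip (x n) v) \<longlonglongrightarrow> tau_lim x v"
  by (simp add: tau_Cauchy_iff tau_lim_def convergent_LIMSEQ_iff)

lemma tau_limI:
  assumes "\<And>v. (\<lambda>n. ip (x n) v) \<longlonglongrightarrow> f v"
  shows "tau_Cauchy ip x" "tau_lim x = f"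
proof -
  show "tau_Cauchy ip x" unfolding tau_Cauchy_iff using assms convergentI by blast
  show "tau_lim x = f" unfolding tau_lim_def using limI[OF assms] by (rule ext)
qed

lemma tau_lim_mem: "tau_Cauchy ip x \<Longrightarrow> tau_lim x \<in> dual_module act"
  by (rule dual_module_limit[OF ip_mem_dual_module tau_lim])

lemma limitin_tau_zero_iff:
  "limitin (tau ip) x 0 sequentially \<longleftrightarrow> (\<forall>z. (\<lambda>n. ip (x n) z) \<longlonglongrightarrow> 0)"
proof (intro iffI allI)
  fix z assume lim: "limitin (tau ip) x 0 sequentially"
  show "(\<lambda>n. ip (x n) z) \<longlonglongrightarrow> 0"
  proof (rule LIMSEQ_I)
    fix e :: real assume e: "e > 0"
    have "openin (tau ip) {y. norm (ip z (y - 0)) < e}"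
      unfolding tau_def using e by (intro topology_generated_by_Basis) blast
    then have "eventually (\<lambda>n. norm (ip z (x n)) < e) sequentially"
      using lim e by (auto simp: limitin_def)
    moreover have "norm (ip (x n) z) = norm (ip z (x n))" for n
      by (metis cstar_ip norm_cstar)
    ultimately show "\<exists>no. \<forall>n\<ge>no. norm (ip (x n) z - 0) < e"
      by (simp add: eventually_sequentially)
  qed
next
  assume lim: "\<forall>z. (\<lambda>n. ip (x n) z) \<longlonglongrightarrow> 0"
  show "limitin (tau ip) x 0 sequentially"
    unfolding tau_def
  proof (rule limitin_topology_generated_byI)
    show "0 \<in> \<Union> {{y. norm (ip z (y - x)) < e} | z x e. e > 0}"
    proof (rule UnionI)
      \<comment> \<open>For z = 0 the seminorm vanishes, so this subbasic set is the whole
        space.\<close>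
      show "{y. norm (ip 0 (y - 0)) < 1} \<in> {{y. norm (ip z (y - x)) < e} | z x e. e > 0}"
        by (intro CollectI exI[of _ "0::'v"] exI[of _ "1::real"]) simp
    qed simp
    fix b assume "b \<in> {{y. norm (ip z (y - x)) < e} | z x e. e > 0}" "0 \<in> b"
    then obtain z p e where b: "b = {y. norm (ip z (y - p)) < e}" and p: "norm (ip z (0 - p)) < e"
      by auto
    have "(\<lambda>n. cstar (ip (x n) z)) \<longlonglongrightarrow> cstar 0"
      using lim by (intro bounded_linear.tendsto[OF bounded_linear_cstar]) auto
    then have "(\<lambda>n. norm (ip z (x n - p))) \<longlonglongrightarrow> norm (ip z (0 - p))"
      unfolding ip_diff_right by (intro tendsto_intros) (simp add: cstar_ip)
    then show "eventually (\<lambda>n. x n \<in> b) sequentially"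
      unfolding b using p order_tendstoD(2) by fastforce
  qed
qed

text \<open>Points of the completion thus correspond to limit functionals, which makes the map to
  the dual module well defined and injective.\<close>

lemma tau_equiv_iff:
  "(x, y) \<in> tau_equiv ip \<longleftrightarrow> tau_Cauchy ip x \<and> tau_Cauchy ip y \<and> tau_lim x = tau_lim y"
proof -
  have "(\<forall>v. (\<lambda>n. ip (x n - y n) v) \<longlonglongrightarrow> 0) \<longleftrightarrow> tau_lim x = tau_lim y"
    if xy: "tau_Cauchy ip x" "tau_Cauchy ip y"
  proof -
    have lim: "(\<lambda>n. ip (x n - y n) v) \<longlonglongrightarrow> tau_lim x v - tau_lim y v" for v
      unfolding ip_diff_left by (intro tendsto_diff tau_lim xy)
    have "((\<lambda>n. ip (x n - y n) v) \<longlonglongrightarrow> 0) \<longleftrightarrow> tau_lim x v = tau_lim y v" for v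
      using LIMSEQ_unique[OF lim, of v 0] lim[of v] by auto
    then show ?thesis by (simp add: fun_eq_iff)
  qed
  then show ?thesis by (auto simp: tau_equiv_def limitin_tau_zero_iff)
qed

lemma mem_tau_class_iff:
  "tau_Cauchy ip x \<Longrightarrow> y \<in> tau_class ip x \<longleftrightarrow> tau_Cauchy ip y \<and> tau_lim y = tau_lim x"
  by (auto simp: tau_class_def tau_equiv_iff)

lemma mem_tau_completion_iff:
  "\<xi> \<in> tau_completion ip \<longleftrightarrow> (\<exists>x. tau_Cauchy ip x \<and> \<xi> = tau_class ip x)"
  by (auto simp: tau_completion_def quotient_def tau_class_def)

text \<open>The choice of a representative is harmless, because all members of a class share the
  same \<open>tau_lim\<close>.\<close>

definition completion_to_dual :: "(nat \<Rightarrow> 'v) set \<Rightarrow> 'v \<Rightarrow> 'a" where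
  "completion_to_dual \<xi> = tau_lim (SOME x. x \<in> \<xi>)"

lemma completion_to_dual_class:
  assumes "tau_Cauchy ip x" shows "completion_to_dual (tau_class ip x) = tau_lim x"
  unfolding completion_to_dual_def
  by (rule someI2[of _ x]) (use assms in \<open>auto simp: mem_tau_class_iff\<close>)

text \<open>Countable generation enters through surjectivity, by way of
  \<open>dual_module_approximable\<close>.\<close>

lemma bij_betw_completion_to_dual:
  assumes "countably_generated act"
  shows "bij_betw completion_to_dual (tau_completion ip) (dual_module act)"
proof (rule bij_betw_imageI)
  show "inj_on completion_to_dual (tau_completion ip)"
  proof (rule inj_onI)
    fix \<xi> \<eta>
    assume "\<xi> \<in> tau_completion ip" "\<eta> \<in> tau_completion ip"
      and eq: "completion_to_dual \<xi> = completion_to_dual \<eta>"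
    then obtain x y where "tau_Cauchy ip x" "\<xi> = tau_class ip x" "tau_Cauchy ip y" "\<eta> = tau_class ip y"
      by (auto simp: mem_tau_completion_iff)
    with eq show "\<xi> = \<eta>" by (auto simp: completion_to_dual_class mem_tau_class_iff)
  qed
  show "completion_to_dual ` tau_completion ip = dual_module act"
  proof
    show "completion_to_dual ` tau_completion ip \<subseteq> dual_module act"
      by (auto simp: mem_tau_completion_iff completion_to_dual_class tau_lim_mem)
    show "dual_module act \<subseteq> completion_to_dual ` tau_completion ip"
    proof
      fix f assume "f \<in> dual_module act"
      with assms obtain x where x: "\<And>v. (\<lambda>n. ip (x n) v) \<longlonglongrightarrow> f v"
        using dual_module_approximable by blast
      then have "f = completion_to_dual (tau_class ip x)"
        using tau_limI[OF x] by (simp add: completion_to_dual_class)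
      then show "f \<in> completion_to_dual ` tau_completion ip"
        using tau_limI(1)[OF x] mem_tau_completion_iff by (intro image_eqI) auto
    qed
  qed
qed

text \<open>All representatives give the same limit, so the definite description is justified, and
  the map to the dual module preserves each pseudometric.\<close>

lemma completion_dist_eq:
  assumes "\<xi> \<in> tau_completion ip" "\<eta> \<in> tau_completion ip"
  shows "completion_dist ip z \<xi> \<eta> = norm (completion_to_dual \<xi> z - completion_to_dual \<eta> z)"
proof -
  obtain x0 y0 where x0: "tau_Cauchy ip x0" "\<xi> = tau_class ip x0"
    and y0: "tau_Cauchy ip y0" "\<eta> = tau_class ip y0"
    using assms by (auto simp: mem_tau_completion_iff)
  let ?d = "norm (tau_lim x0 z - tau_lim y0 z)"
  have lim: "(\<lambda>n. norm (ip z (x n - y n))) \<longlonglongrightarrow> ?d" if "x \<in> \<xi>" "y \<in> \<eta>" for x y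
  proof -
    have xy: "tau_Cauchy ip x" "tau_Cauchy ip y" "tau_lim x = tau_lim x0" "tau_lim y = tau_lim y0"
      using that x0 y0 by (auto simp: mem_tau_class_iff)
    have "(\<lambda>n. norm (ip (x n) z - ip (y n) z)) \<longlonglongrightarrow> norm (tau_lim x z - tau_lim y z)"
      by (intro tendsto_intros tau_lim xy)
    then have "(\<lambda>n. norm (ip (x n) z - ip (y n) z)) \<longlonglongrightarrow> ?d" by (simp only: xy)
    moreover have "norm (ip z (x n - y n)) = norm (ip (x n) z - ip (y n) z)" for n
      unfolding ip_diff_left[symmetric] using norm_cstar[of "ip (x n - y n) z"] by (simp only: cstar_ip)
    ultimately show ?thesis by simp
  qed
  have "completion_dist ip z \<xi> \<eta> = ?d"
    unfolding completion_dist_def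
  proof (rule the_equality)
    have "x0 \<in> \<xi>" "y0 \<in> \<eta>" using x0 y0 by (auto simp: mem_tau_class_iff)
    then show "\<exists>x\<in>\<xi>. \<exists>y\<in>\<eta>. (\<lambda>n. norm (ip z (x n - y n))) \<longlonglongrightarrow> ?d" using lim by blast
    show "d = ?d" if "\<exists>x\<in>\<xi>. \<exists>y\<in>\<eta>. (\<lambda>n. norm (ip z (x n - y n))) \<longlonglongrightarrow> d" for d
      using that lim LIMSEQ_unique by blast
  qed
  then show ?thesis by (simp add: x0 y0 completion_to_dual_class)
qed

lemma homeomorphic_map_completion_to_dual:
  assumes "countably_generated act"
  shows "homeomorphic_map (completion_topology ip) (dual_topology act) completion_to_dual"
proof -
  note bij = bij_betw_completion_to_dual[OF assms]
  let ?ball = "\<lambda>z \<xi> e. {\<eta> \<in> tau_completion ip. completion_dist ip z \<xi> \<eta> < e}"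
  let ?dball = "\<lambda>z f e. {g \<in> dual_module act. norm (g z - f z) < e}"
  let ?B = "{?ball z \<xi> e | z \<xi> e. \<xi> \<in> tau_completion ip \<and> e > 0}"
  let ?C = "{?dball z f e | z f e. f \<in> dual_module act \<and> e > 0}"
  have img: "completion_to_dual ` ?ball z \<xi> e = ?dball z (completion_to_dual \<xi>) e"
    if \<xi>: "\<xi> \<in> tau_completion ip" for z \<xi> e
  proof -
    have "?ball z \<xi> e = {\<eta> \<in> tau_completion ip.
        norm (completion_to_dual \<eta> z - completion_to_dual \<xi> z) < e}"
      using \<xi> by (auto simp: completion_dist_eq norm_minus_commute)
    then show ?thesis unfolding bij_betw_imp_surj_on[OF bij, symmetric] by auto
  qed
  have C: "?C = (\<lambda>b. completion_to_dual ` b) ` ?B"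
  proof (intro equalityI subsetI)
    fix c assume "c \<in> ?C"
    then obtain z f e where c: "c = ?dball z f e" "f \<in> dual_module act" "e > 0" by blast
    then obtain \<xi> where "\<xi> \<in> tau_completion ip" "f = completion_to_dual \<xi>"
      using bij by (auto simp: bij_betw_def)
    with c show "c \<in> (\<lambda>b. completion_to_dual ` b) ` ?B"
      by (intro image_eqI[of _ _ "?ball z \<xi> e"]) (auto simp: img)
  next
    fix c assume "c \<in> (\<lambda>b. completion_to_dual ` b) ` ?B"
    then obtain z \<xi> e where "c = completion_to_dual ` ?ball z \<xi> e" "\<xi> \<in> tau_completion ip" "e > 0"
      by blast
    moreover from this have "completion_to_dual \<xi> \<in> dual_module act"
      using bij_betw_imp_surj_on[OF bij] by blast
    ultimately show "c \<in> ?C" unfolding \<open>c = _\<close> img[OF \<open>\<xi> \<in> _\<close>] by blast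
  qed
  have UB: "\<Union>?B = tau_completion ip"
  proof (intro equalityI subsetI)
    fix \<xi> assume \<xi>: "\<xi> \<in> tau_completion ip"
    then have "?ball 0 \<xi> 1 \<in> ?B"
      by (intro CollectI exI[of _ "0::'v"] exI[of _ \<xi>] exI[of _ "1::real"]) simp
    moreover have "\<xi> \<in> ?ball 0 \<xi> 1" using \<xi> by (simp add: completion_dist_eq)
    ultimately show "\<xi> \<in> \<Union>?B" by (rule UnionI)
  qed auto
  have UC: "\<Union>?C = dual_module act"
  proof (intro equalityI subsetI)
    fix f assume f: "f \<in> dual_module act"
    then have "?dball 0 f 1 \<in> ?C"
      by (intro CollectI exI[of _ "0::'v"] exI[of _ f] exI[of _ "1::real"]) simp
    moreover have "f \<in> ?dball 0 f 1" using f by simp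
    ultimately show "f \<in> \<Union>?C" by (rule UnionI)
  qed auto
  show ?thesis
    unfolding completion_topology_def dual_topology_def
    by (rule homeomorphic_map_topology_generated_by) (simp_all only: UB UC bij C[symmetric])
qed

text \<open>Adjoining limits of Cauchy sequences once need not give a sequentially complete space
  when the topology is not metrizable. Here the pointwise limit of the functionals is again in the
  dual module, and surjectivity returns it to the completion.\<close>

lemma completion_complete:
  assumes cg: "countably_generated act" and \<xi>: "\<And>k. \<xi> k \<in> tau_completion ip"
    and Cauchy: "\<And>z e. e > 0 \<Longrightarrow> \<exists>N. \<forall>m\<ge>N. \<forall>n\<ge>N. completion_dist ip z (\<xi> m) (\<xi> n) < e"
  shows "\<exists>\<eta> \<in> tau_completion ip. limitin (completion_topology ip) \<xi> \<eta> sequentially"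
proof -
  note bij = bij_betw_completion_to_dual[OF cg]
  have "Cauchy (\<lambda>k. completion_to_dual (\<xi> k) z)" for z
    using Cauchy by (intro CauchyI) (simp add: completion_dist_eq \<xi>)
  then have conv: "(\<lambda>k. completion_to_dual (\<xi> k) z) \<longlonglongrightarrow> lim (\<lambda>k. completion_to_dual (\<xi> k) z)" for z
    by (simp add: Cauchy_convergent_iff convergent_LIMSEQ_iff)
  have "(\<lambda>z. lim (\<lambda>k. completion_to_dual (\<xi> k) z)) \<in> dual_module act"
    by (rule dual_module_limit[OF bij_betwE[OF bij, rule_format, OF \<xi>] conv])
  then have "(\<lambda>z. lim (\<lambda>k. completion_to_dual (\<xi> k) z)) \<in> completion_to_dual ` tau_completion ip"
    by (simp only: bij_betw_imp_surj_on[OF bij])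
  then obtain \<eta> where eq: "(\<lambda>z. lim (\<lambda>k. completion_to_dual (\<xi> k) z)) = completion_to_dual \<eta>"
    and \<eta>: "\<eta> \<in> tau_completion ip"
    by (rule imageE)
  have lim: "(\<lambda>k. completion_to_dual (\<xi> k) z) \<longlonglongrightarrow> completion_to_dual \<eta> z" for z
    using conv[of z] fun_cong[OF eq, of z] by simp
  have "limitin (completion_topology ip) \<xi> \<eta> sequentially"
    unfolding completion_topology_def
  proof (rule limitin_topology_generated_byI)
    let ?ball = "\<lambda>z \<xi> e. {\<eta> \<in> tau_completion ip. completion_dist ip z \<xi> \<eta> < e}"
    show "\<eta> \<in> \<Union> {?ball z \<xi> e | z \<xi> e. \<xi> \<in> tau_completion ip \<and> e > 0}"
    proof (rule UnionI)
      show "?ball 0 \<eta> 1 \<in> {?ball z \<xi> e | z \<xi> e. \<xi> \<in> tau_completion ip \<and> e > 0}"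
        using \<eta> by (intro CollectI exI[of _ "0::'v"] exI[of _ \<eta>] exI[of _ "1::real"]) simp
      show "\<eta> \<in> ?ball 0 \<eta> 1" using \<eta> by (simp add: completion_dist_eq)
    qed
    fix b assume "b \<in> {?ball z \<xi> e | z \<xi> e. \<xi> \<in> tau_completion ip \<and> e > 0}" "\<eta> \<in> b"
    then obtain z \<zeta> e where b: "b = ?ball z \<zeta> e" "\<zeta> \<in> tau_completion ip"
      and "completion_dist ip z \<zeta> \<eta> < e" by blast
    then have less: "norm (completion_to_dual \<zeta> z - completion_to_dual \<eta> z) < e"
      using \<eta> by (simp add: completion_dist_eq)
    have "(\<lambda>k. norm (completion_to_dual \<zeta> z - completion_to_dual (\<xi> k) z))
        \<longlonglongrightarrow> norm (completion_to_dual \<zeta> z - completion_to_dual \<eta> z)"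
      by (intro tendsto_intros lim)
    from order_tendstoD(2)[OF this less] show "eventually (\<lambda>k. \<xi> k \<in> b) sequentially"
      by eventually_elim (simp add: b \<xi> completion_dist_eq)
  qed
  with \<eta> show ?thesis by blast
qed

end

theorem theorem6p3:
  fixes act :: "'v::complex_banach \<Rightarrow> 'a::unital_cstar_algebra \<Rightarrow> 'v"
    and ip :: "'v \<Rightarrow> 'v \<Rightarrow> 'a"
  assumes "hilbert_module act ip"
    and "countably_generated act"
  shows "\<exists>\<Phi> :: (nat \<Rightarrow> 'v) set \<Rightarrow> ('v \<Rightarrow> 'a).
    bij_betw \<Phi> (tau_completion ip) (dual_module act) \<and>
    (\<forall>x. \<Phi> (tau_class ip (\<lambda>n. x)) = (\<lambda>v. ip x v)) \<and>
    homeomorphic_map (completion_topology ip) (dual_topology act) \<Phi> \<and>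
    (\<forall>x y. tau_Cauchy ip x \<and> tau_Cauchy ip y \<longrightarrow>
       \<Phi> (tau_class ip (\<lambda>n. x n + y n)) = (\<lambda>v. \<Phi> (tau_class ip x) v + \<Phi> (tau_class ip y) v)) \<and>
    (\<forall>x c. tau_Cauchy ip x \<longrightarrow>
       \<Phi> (tau_class ip (\<lambda>n. c *\<^sub>C x n)) = (\<lambda>v. cnj c *\<^sub>C \<Phi> (tau_class ip x) v)) \<and>
    (\<forall>x a. tau_Cauchy ip x \<longrightarrow>
       \<Phi> (tau_class ip (\<lambda>n. act (x n) a)) = (\<lambda>v. cstar a * \<Phi> (tau_class ip x) v)) \<and>
    (\<forall>\<xi> :: nat \<Rightarrow> (nat \<Rightarrow> 'v) set.
       (\<forall>k. \<xi> k \<in> tau_completion ip) \<and>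
       (\<forall>z. \<forall>e>0. \<exists>N. \<forall>m\<ge>N. \<forall>n\<ge>N. completion_dist ip z (\<xi> m) (\<xi> n) < e) \<longrightarrow>
       (\<exists>\<eta> \<in> tau_completion ip. limitin (completion_topology ip) \<xi> \<eta> sequentially))"
proof -
  interpret hilbert_module act ip by (rule assms)
  \<comment> \<open>All algebraic identities for the map reduce to computing the limit of <x_n,
    v>.\<close>
  have val: "completion_to_dual (tau_class ip x) = f" if "\<And>v. (\<lambda>n. ip (x n) v) \<longlonglongrightarrow> f v" for x f
    using tau_limI[OF that] by (simp add: completion_to_dual_class)
  show ?thesis
  proof (intro exI[of _ completion_to_dual] conjI allI impI)
    show "bij_betw completion_to_dual (tau_completion ip) (dual_module act)"
      by (rule bij_betw_completion_to_dual[OF assms(2)])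
    show "homeomorphic_map (completion_topology ip) (dual_topology act) completion_to_dual"
      by (rule homeomorphic_map_completion_to_dual[OF assms(2)])
    show "completion_to_dual (tau_class ip (\<lambda>n. x)) = (\<lambda>v. ip x v)" for x
      by (rule val) simp
    show "completion_to_dual (tau_class ip (\<lambda>n. x n + y n)) =
        (\<lambda>v. completion_to_dual (tau_class ip x) v + completion_to_dual (tau_class ip y) v)"
      if "tau_Cauchy ip x \<and> tau_Cauchy ip y" for x y
    proof (rule val)
      show "(\<lambda>n. ip (x n + y n) v) \<longlonglongrightarrow>
          completion_to_dual (tau_class ip x) v + completion_to_dual (tau_class ip y) v" for v
        using tendsto_add[OF tau_lim tau_lim] that by (simp add: completion_to_dual_class ip_add_left)
    qed
    show "completion_to_dual (tau_class ip (\<lambda>n. c *\<^sub>C x n)) =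
        (\<lambda>v. cnj c *\<^sub>C completion_to_dual (tau_class ip x) v)" if "tau_Cauchy ip x" for x c
      using that by (intro val)
        (auto simp: completion_to_dual_class ip_scaleC_left
          intro!: bounded_linear.tendsto[OF bounded_linear_scaleC] tau_lim)
    show "completion_to_dual (tau_class ip (\<lambda>n. act (x n) a)) =
        (\<lambda>v. cstar a * completion_to_dual (tau_class ip x) v)" if "tau_Cauchy ip x" for x a
      using that by (intro val)
        (auto simp: completion_to_dual_class ip_act_left intro!: tendsto_mult tau_lim)
    show "\<exists>\<eta> \<in> tau_completion ip. limitin (completion_topology ip) \<xi> \<eta> sequentially"
      if "(\<forall>k. \<xi> k \<in> tau_completion ip) \<and>
        (\<forall>z. \<forall>e>0. \<exists>N. \<forall>m\<ge>N. \<forall>n\<ge>N. completion_dist ip z (\<xi> m) (\<xi> n) < e)"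
      for \<xi> :: "nat \<Rightarrow> (nat \<Rightarrow> 'v) set"
      by (rule completion_complete[OF assms(2)])
        (rule that[THEN conjunct1, rule_format], rule that[THEN conjunct2, rule_format])
  qed
qed

end
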